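(* Let $\alpha(\sigma)$ denote the number of occurrences of the arrow pattern $\alpha=(12;1\to3)$ in a permutation $\sigma$, and for $\pi\in\{213,231\}$ let $$R^{\pi}(q,x):=1+\sum_{n\ge1}x^n\sum_{\sigma\in\mathfrak{S}_n(\pi)}q^{\alpha(\sigma)},$$ where $\mathfrak{S}_n(\pi)$ is the set of permutations in $\mathfrak{S}_n$ avoiding the classical pattern $\pi$. Let $C(t,q,x)$ be the formal power series in $x$ given by the continued fraction $$C(t,q,x)=\cfrac{1}{1-\cfrac{x}{1-\cfrac{tx}{1-\cfrac{qx}{1-\cfrac{tqx}{1-\cfrac{q^2x}{1-\cfrac{tq^2x}{\ddots}}}}}}}.$$ Then $$R^{213}(q,x)=R^{231}(q,x)=\frac{1}{1-x\,C(1,q,x)}.$$ In particular, for every $n\ge1$, $$a_n(213,\alpha)=a_n(231,\alpha)=F_{2n-1},$$ where $a_n(\pi,\alpha)$ is the number of permutations in $\mathfrak{S}_n$ that avoid both the classical pattern $\pi$ and the arrow pattern $\alpha$, and $F_n$ is the $n$-th Fibonacci number ($F_1=F_2=1$, $F_{n}=F_{n-1}+F_{n-2}$).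
   Context: $\mathfrak{S}_n$ is the set of permutations of $[n]=\{1,\dots,n\}$, written in one-line notation $\sigma=\sigma_1\cdots\sigma_n$ with $\sigma_i=\sigma(i)$. A permutation $\sigma\in\mathfrak{S}_n$ contains the classical pattern $\pi\in\mathfrak{S}_m$ if there are $1\le i_1<\cdots<i_m\le n$ such that $\sigma_{i_1}\cdots\sigma_{i_m}$ is order-isomorphic to $\pi$; otherwise it avoids $\pi$. Standard cycle notation: every cycle (including fixed points) is written as $(a\ \sigma(a)\ \sigma^2(a)\cdots)$ beginning with its maximal element $a$, and the cycles are listed from left to right in increasing order of their maximal elements. The bijection $\Phi:\mathfrak{S}_n\to\mathfrak{S}_n$ sends $\sigma$ to the permutation whose one-line notation is obtained by erasing the parentheses in the standard cycle notation of $\sigma$. For $\sigma\in\mathfrak{S}_n$ write $\hat\sigma=\Phi^{-1}(\sigma)$. An arrow pattern of size $k$ is a pair $(\nu;H)$ with $\nu=a_1\ldots a_m$ a string of positive integers and $H=\{b_i\to c_i:1\le i\le h\}$ a (possibly empty) set of arrows, such that the distinct integers appearing in $\nu$ or $H$ form $[k]$. An occurrence of $(\nu;H)$ in $\sigma\in\mathfrak{S}_n$ is a subset $X=\{x_1<\cdots<x_k\}\subseteq[n]$ such that (1) $\sigma_{t_1}\cdots\sigma_{t_m}=x_{a_1}\cdots x_{a_m}$ for some indices $t_1<\cdots<t_m$, and (2) $\hat\sigma(x_{b_i})=x_{c_i}$ for all $1\le i\le h$; $\sigma$ avoids the arrow pattern if it has no occurrence. In particular, $\alpha(\sigma)$ is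 the number of triples $x_1<x_2<x_3$ in $[n]$ such that $x_1$ appears to the left of $x_2$ in the one-line notation of $\sigma$ and $\hat\sigma(x_1)=x_3$. In the continued fraction, the successive partial numerators after the first are $x,\ tx,\ qx,\ tqx,\ q^2x,\ tq^2x,\dots$, i.e. $q^{k-1}x$ and then $tq^{k-1}x$ for $k=1,2,3,\dots$, all partial numerators being subtracted from $1$. *)

theory Defs
  imports
    "HOL-Combinatorics.Combinatorics"
    "HOL-Computational_Algebra.Formal_Power_Series"
    "HOL-Computational_Algebra.Polynomial"
    "HOL-Number_Theory.Fib"
begin

unbundle fps_syntax

section \<open>Permutations of [n] and classical patterns\<close>

text \<open>Permutations of \<open>[n]\<close> are functions on \<open>nat\<close> permuting \<open>{1..n}\<close>
  (hence the identity elsewhere).\<close>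

definition perms :: "nat \<Rightarrow> (nat \<Rightarrow> nat) set" where
  "perms n = {\<sigma>. \<sigma> permutes {1..n}}"

text \<open>Index sequences \<open>1 \<le> t\<^sub>1 < \<dots> < t\<^sub>m \<le> n\<close>.\<close>

definition index_seqs :: "nat \<Rightarrow> nat \<Rightarrow> nat list set" where
  "index_seqs n m = {ts. length ts = m \<and> sorted_wrt (<) ts \<and> set ts \<subseteq> {1..n}}"

text \<open>A classical pattern is given by the list of its one-line notation.\<close>

definition contains :: "nat \<Rightarrow> (nat \<Rightarrow> nat) \<Rightarrow> nat list \<Rightarrow> bool" where
  "contains n \<sigma> \<pi> \<longleftrightarrow>
     (\<exists>ts \<in> index_seqs n (length \<pi>). \<forall>i < length \<pi>. \<forall>j < length \<pi>.
        \<sigma> (ts ! i) < \<sigma> (ts ! j) \<longleftrightarrow> \<pi> ! i < \<pi> ! j)"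

definition avoiders :: "nat \<Rightarrow> nat list \<Rightarrow> (nat \<Rightarrow> nat) set" where
  "avoiders n \<pi> = {\<sigma> \<in> perms n. \<not> contains n \<sigma> \<pi>}"


section \<open>The fundamental bijection\<close>

text \<open>\<^term>\<open>support \<sigma> a\<close> is the list \<open>[a, \<sigma> a, \<sigma>\<^sup>2 a, \<dots>]\<close> of the cycle through \<open>a\<close>.\<close>

definition std_cycles :: "nat \<Rightarrow> (nat \<Rightarrow> nat) \<Rightarrow> nat list list" where
  "std_cycles n \<sigma> =
     map (support \<sigma>) (filter (\<lambda>a. a = Max (set (support \<sigma> a))) [1..<Suc n])"

definition Phi :: "nat \<Rightarrow> (nat \<Rightarrow> nat) \<Rightarrow> nat \<Rightarrow> nat" where
  "Phi n \<sigma> = (\<lambda>i. if i \<in> {1..n} then concat (std_cycles n \<sigma>) ! (i - 1) else i)"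

definition hat :: "nat \<Rightarrow> (nat \<Rightarrow> nat) \<Rightarrow> nat \<Rightarrow> nat" where
  "hat n \<sigma> = inv_into (perms n) (Phi n) \<sigma>"


section \<open>Arrow patterns\<close>

text \<open>The pair \<open>(\<nu>, H)\<close>, where \<open>(b, c) \<in> H\<close> stands for the arrow \<open>b \<rightarrow> c\<close>. The letters
  occurring in an arrow pattern are meant to be exactly \<open>{1..k}\<close>, so that \<open>k\<close> is their number.\<close>

type_synonym arrow_pattern = "nat list \<times> (nat \<times> nat) set"

definition arrow_size :: "arrow_pattern \<Rightarrow> nat" where
  "arrow_size p = card (set (fst p) \<union> fst ` snd p \<union> snd ` snd p)"

definition nth_smallest :: "nat set \<Rightarrow> nat \<Rightarrow> nat" where
  "nth_smallest X i = sorted_list_of_set X ! (i - 1)"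

definition arrow_occurrences :: "arrow_pattern \<Rightarrow> nat \<Rightarrow> (nat \<Rightarrow> nat) \<Rightarrow> nat set set" where
  "arrow_occurrences p n \<sigma> =
     {X. X \<subseteq> {1..n} \<and> card X = arrow_size p \<and>
         (\<exists>ts \<in> index_seqs n (length (fst p)). map \<sigma> ts = map (nth_smallest X) (fst p)) \<and>
         (\<forall>(b, c) \<in> snd p. hat n \<sigma> (nth_smallest X b) = nth_smallest X c)}"

definition alpha_pattern :: arrow_pattern where
  "alpha_pattern = ([1, 2], {(1, 3)})"

definition alpha :: "nat \<Rightarrow> (nat \<Rightarrow> nat) \<Rightarrow> nat" where
  "alpha n \<sigma> = card (arrow_occurrences alpha_pattern n \<sigma>)"

definition a_count :: "nat \<Rightarrow> nat list \<Rightarrow> arrow_pattern \<Rightarrow> nat" where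
  "a_count n \<pi> p = card {\<sigma> \<in> avoiders n \<pi>. arrow_occurrences p n \<sigma> = {}}"

definition R :: "nat list \<Rightarrow> 'a::comm_ring_1 \<Rightarrow> 'a fps" where
  "R \<pi> q = 1 + Abs_fps (\<lambda>n. if n \<ge> 1 then \<Sum>\<sigma> \<in> avoiders n \<pi>. q ^ alpha n \<sigma> else 0)"


section \<open>The continued fraction\<close>

text \<open>Over a coefficient ring that is not a field, a power series with constant term \<open>1\<close> still
  has a (unique) multiplicative inverse, but \<^const>\<open>inverse\<close> is not available for it.\<close>

definition fps_recip :: "'a::comm_ring_1 fps \<Rightarrow> 'a fps" where
  "fps_recip f = fps_right_inverse f 1"

lemma fps_recip: "f $ 0 = 1 \<Longrightarrow> f * fps_recip f = 1"
  unfolding fps_recip_def by (rule fps_right_inverse) simp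

text \<open>The convergent \<open>1 / (1 - c\<^sub>0 / (1 - c\<^sub>1 / (\<dots> / (1 - c\<^sub>N\<^sub>-\<^sub>1))))\<close>.\<close>

primrec convergent_cf :: "nat \<Rightarrow> (nat \<Rightarrow> 'a::comm_ring_1 fps) \<Rightarrow> 'a fps" where
  "convergent_cf 0 c = 1"
| "convergent_cf (Suc N) c = fps_recip (1 - c 0 * convergent_cf N (\<lambda>k. c (Suc k)))"

definition C_numerator :: "'a::comm_ring_1 \<Rightarrow> 'a \<Rightarrow> nat \<Rightarrow> 'a fps" where
  "C_numerator t q k =
     (if even k then fps_const (q ^ (k div 2)) else fps_const (t * q ^ (k div 2))) * fps_X"

text \<open>The limit is taken in the \<open>x\<close>-adic topology; it exists by \<open>C_convergents\<close> below.\<close>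

definition C :: "'a::comm_ring_1 \<Rightarrow> 'a \<Rightarrow> 'a fps" where
  "C t q = lim (\<lambda>N. convergent_cf N (C_numerator t q))"

lemma convergent_cf_step:
  assumes "\<And>k. fps_X dvd c k"
  shows "fps_X ^ N dvd convergent_cf (Suc N) c - convergent_cf N c"
  using assms
proof (induction N arbitrary: c)
  case 0
  then show ?case by simp
next
  case (Suc N)
  define f where "f = convergent_cf (Suc N) (\<lambda>k. c (Suc k))"
  define g where "g = convergent_cf N (\<lambda>k. c (Suc k))"
  define A where "A = 1 - c 0 * f"
  define B where "B = 1 - c 0 * g"
  obtain d where d: "c 0 = fps_X * d" using Suc.prems[of 0] by (auto elim: dvdE)
  have A: "A * fps_recip A = 1" and B: "B * fps_recip B = 1"
    by (rule fps_recip; simp add: A_def B_def d)+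
  have "fps_recip A - fps_recip B =
          (B * fps_recip B) * fps_recip A - (A * fps_recip A) * fps_recip B"
    by (simp only: A B mult_1)
  also have "\<dots> = (c 0 * (f - g)) * (fps_recip A * fps_recip B)"
    by (simp add: A_def B_def algebra_simps)
  finally have eq: "fps_recip A - fps_recip B = \<dots>" .
  have "fps_X ^ N dvd f - g"
    unfolding f_def g_def by (rule Suc.IH) (rule Suc.prems)
  hence "fps_X * fps_X ^ N dvd c 0 * (f - g)"
    by (intro mult_dvd_mono Suc.prems)
  hence "fps_X ^ Suc N dvd fps_recip A - fps_recip B"
    unfolding eq by (simp add: dvd_mult2)
  thus ?case unfolding A_def B_def f_def g_def by simp
qed

lemma C_convergents: "(\<lambda>N. convergent_cf N (C_numerator t q)) \<longlonglongrightarrow> C t q"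
proof -
  let ?F = "\<lambda>N. convergent_cf N (C_numerator t q)"
  have step: "?F (Suc N) $ n = ?F N $ n" if "n < N" for n N
  proof -
    have "fps_X ^ N dvd ?F (Suc N) - ?F N"
      by (rule convergent_cf_step) (simp add: C_numerator_def)
    then obtain h where "?F (Suc N) - ?F N = fps_X ^ N * h" by (auto elim: dvdE)
    hence "(?F (Suc N) - ?F N) $ n = 0" using that by (simp add: fps_X_power_mult_nth)
    thus ?thesis by simp
  qed
  have stable: "?F N $ n = ?F (Suc n) $ n" if "Suc n \<le> N" for n N
    using that by (induction N rule: dec_induct) (auto simp del: convergent_cf.simps simp: step)
  have "?F \<longlonglongrightarrow> Abs_fps (\<lambda>n. ?F (Suc n) $ n)"
  proof (rule tendsto_fpsI)
    fix n
    show "\<forall>\<^sub>F N in sequentially. ?F N $ n = Abs_fps (\<lambda>n. ?F (Suc n) $ n) $ n"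
      unfolding fps_nth_Abs_fps
      by (rule eventually_mono[OF eventually_ge_at_top[of "Suc n"]]) (rule stable)
  qed
  hence "convergent ?F" by (rule convergentI)
  thus ?thesis unfolding C_def by (simp add: convergent_LIMSEQ_iff)
qed

text \<open>The indeterminate \<open>q\<close> of the coefficient ring \<open>\<int>[q]\<close>.\<close>

abbreviation q_var :: "int poly" where
  "q_var \<equiv> [:0, 1:]"

end

theory Submission
  imports Defs "HOL-Library.Tree"
begin

text \<open>
Write a permutation \<open>\<sigma>\<close> as the word \<open>w = \<sigma>\<^sub>1 \<dots> \<sigma>\<^sub>n\<close> and cut \<open>w\<close> in front of each left-to-right
maximum. The resulting blocks are the cycles of the preimage \<open>h\<close> of \<open>\<sigma>\<close> under the fundamental
bijection, so \<open>h\<close> maps each letter to the next letter of its block, and the last letter of a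
block to the head of the block (\<open>hat_eq_cycles_perm\<close>). Hence \<open>\<alpha>(\<sigma>)\<close> counts the pairs of
positions \<open>i < j\<close> with \<open>w\<^sub>i < w\<^sub>j < h(w\<^sub>i)\<close> (\<open>alpha_eq_alpha_word\<close>). Inside one block this is the
number of occurrences of the vincular pattern 13-2, in which the letters that play 1 and 3 are
adjacent: the last letter of a word has nothing to its right, and the head of a block is its
maximum. That number is called \<open>vinc\<close> below.

A nonempty 231-avoiding word is \<open>L n M\<close> with \<open>L < M < n\<close>, and then
\<open>\<alpha>(L n M) = \<alpha>(L) + vinc M\<close> and \<open>vinc (L n M) = vinc L + vinc M + |M|\<close>, where the term \<open>|M|\<close> is
absent if \<open>L\<close> is empty: it counts the letters between the last letter of \<open>L\<close> and \<open>n\<close>.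
A nonempty 213-avoiding word is \<open>a U D\<close> with \<open>D < a < U\<close>, and then
\<open>\<alpha>(a U D) = \<alpha>(U) + vinc D\<close> and \<open>vinc (a U D) = vinc U + vinc D + m\<close>, where \<open>m\<close> is the number
of letters of \<open>U\<close> below its first letter: they lie between \<open>a\<close> and its successor.
Both decompositions identify the avoiding permutations of \<open>[n]\<close> with the binary trees with \<open>n\<close>
nodes, and the four recursions become recursions on trees.

Let \<open>F(x)\<close> be the generating function of \<open>vinc\<close>. In both cases the recursion for \<open>\<alpha>\<close> gives
\<open>R = 1 + x R F\<close>, so it remains to see that \<open>F = C(1,q,x)\<close>. Both recursions for \<open>vinc\<close> lead to a
series \<open>G\<close> with \<open>F(x) = 1 / (1 - x G(x))\<close> and \<open>G(x) = 1 / (1 - x F(q x))\<close>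
(\<open>vinc213_gf_relations\<close>, \<open>vinc231_gf\<close>). Substituting \<open>q\<^sup>k x\<close> for \<open>x\<close> turns these two relations
into the successive levels of the continued fraction, whose convergents therefore tend to \<open>F\<close>
(\<open>C_one_eqI\<close>).

For \<open>q = 0\<close> the sum \<open>\<Sum> q\<^bsup>\<alpha>(\<sigma>)\<^esup>\<close> counts the permutations with \<open>\<alpha>(\<sigma>) = 0\<close>. The relations become
\<open>F = (1 - x) / (1 - 2x)\<close> and \<open>R = (1 - 2x) / (1 - 3x + x\<^sup>2)\<close>, whose coefficients satisfy the
recurrence of the Fibonacci numbers of odd index.
\<close>

section \<open>The inverse of the fundamental bijection on words\<close>

text \<open>The first letter that is not smaller than the left-to-right maximum \<open>x\<close> is the next one and
  opens the next block.\<close>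

function blocks :: "nat list \<Rightarrow> nat list list" where
  "blocks [] = []"
| "blocks (x # w) = (x # takeWhile (\<lambda>y. y < x) w) # blocks (dropWhile (\<lambda>y. y < x) w)"
  by pat_completeness auto
termination by (relation "measure length") (auto simp: less_Suc_eq_le length_dropWhile_le)

lemma concat_blocks [simp]: "concat (blocks w) = w"
  by (induction w rule: blocks.induct) auto

lemma in_set_blocks:
  assumes "b \<in> set (blocks w)"
  shows "b \<noteq> []" "hd b = Max (set b)"
proof -
  have *: "b \<noteq> [] \<and> (\<forall>y \<in> set b. y \<le> hd b)"
    using assms by (induction w rule: blocks.induct) (auto dest!: set_takeWhileD)
  thus "b \<noteq> []" by blast
  thus "hd b = Max (set b)" using * by (intro Max_eqI[symmetric]) auto
qed

lemma sorted_block_heads: "distinct w \<Longrightarrow> sorted_wrt (<) (map hd (blocks w))"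
proof (induction w rule: blocks.induct)
  case (2 x w)
  define w' where "w' = dropWhile (\<lambda>y. y < x) w"
  have IH: "sorted_wrt (<) (map hd (blocks w'))" using 2 by (simp add: w'_def)
  have "\<forall>b \<in> set (blocks w'). x < hd b"
  proof (cases w')
    case (Cons y v)
    hence "\<not> y < x" using hd_dropWhile[of "\<lambda>y. y < x" w] by (auto simp: w'_def)
    moreover have "y \<in> set w" using Cons by (metis list.set_intros(1) set_dropWhileD w'_def)
    ultimately have "x < y" using 2(2) by (metis distinct.simps(2) nat_neq_iff)
    thus ?thesis using IH by (auto simp: Cons)
  qed simp
  thus ?case using IH by (simp add: w'_def)
qed simp

text \<open>The images of the letters of \<open>w\<close>, in the order of \<open>w\<close>, under the permutation whose cycles
  are the blocks of \<open>w\<close>; see \<open>hat_word_nth\<close>.\<close>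

definition hat_word :: "nat list \<Rightarrow> nat list" where
  "hat_word w = concat (map rotate1 (blocks w))"

lemma length_hat_word [simp]: "length (hat_word w) = length w"
proof -
  have "length (hat_word w) = length (concat (blocks w))"
    unfolding hat_word_def length_concat by (simp add: o_def)
  thus ?thesis by simp
qed

lemma set_hat_word [simp]: "set (hat_word w) = set w"
proof -
  have "set (hat_word w) = set (concat (blocks w))"
    unfolding hat_word_def set_concat by simp
  thus ?thesis by simp
qed

primrec cycles_perm :: "nat list list \<Rightarrow> nat \<Rightarrow> nat" where
  "cycles_perm [] = id"
| "cycles_perm (b # bs) = cycle_of_list b \<circ> cycles_perm bs"

lemma cycles_perm_permutes: "cycles_perm bs permutes set (concat bs)"
proof (induction bs)
  case (Cons b bs)
  show ?case unfolding cycles_perm.simps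
    by (intro permutes_compose permutes_subset[OF Cons.IH] permutes_subset[OF cycle_permutes]) auto
qed (simp add: id_def permutes_id[unfolded id_def])

lemma cycles_perm_apply:
  "distinct (concat bs) \<Longrightarrow> b \<in> set bs \<Longrightarrow> x \<in> set b \<Longrightarrow> cycles_perm bs x = cycle_of_list b x"
proof (induction bs)
  case (Cons c bs)
  have disj: "set c \<inter> set (concat bs) = {}" using Cons.prems by auto
  show ?case
  proof (cases "b \<in> set bs")
    case True
    have "cycle_of_list b x \<in> set b"
      using Cons.prems(3) permutes_in_image[OF cycle_permutes] by metis
    hence "cycle_of_list b x \<notin> set c" using True disj by auto
    thus ?thesis using True Cons by (simp add: id_outside_supp)
  next
    case False
    hence [simp]: "b = c" using Cons.prems by auto
    have "x \<notin> set (concat bs)" using disj Cons.prems by auto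
    hence "cycles_perm bs x = x" using cycles_perm_permutes permutes_not_in by metis
    thus ?thesis by simp
  qed
qed simp

lemma map_cycles_perm_block:
  assumes "distinct (concat bs)" "b \<in> set bs"
  shows "map (cycles_perm bs) b = rotate1 b"
proof -
  have "distinct b" using assms by (induction bs) auto
  hence "map (cycle_of_list b) b = rotate1 b" using cyclic_rotation[of b 1] by simp
  thus ?thesis using cycles_perm_apply[OF assms] by (metis (no_types, lifting) map_eq_conv)
qed

lemma map_cycles_perm_concat:
  assumes "distinct (concat bs)"
  shows "map (cycles_perm bs) (concat bs) = concat (map rotate1 bs)"
proof -
  have "map (map (cycles_perm bs)) bs = map rotate1 bs"
    using map_cycles_perm_block[OF assms] by simp
  thus ?thesis unfolding map_concat by (rule arg_cong)
qed

text \<open>The iterates of the first entry run through \<open>b\<close> and return to it for the first time after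
  \<open>length b\<close> steps, because the entries are distinct.\<close>

lemma support_hd:
  assumes "distinct b" "b \<noteq> []" and rot: "map p b = rotate1 b"
  shows "support p (hd b) = b"
proof -
  have step: "p (b ! i) = b ! (Suc i mod length b)" if "i < length b" for i
    using arg_cong[OF rot, of "\<lambda>w. w ! i"] that by (simp add: nth_rotate1)
  have pow: "(p ^^ i) (hd b) = b ! (i mod length b)" for i
    using assms(2) by (induction i) (auto simp: hd_conv_nth step mod_Suc_eq)
  have "least_power p (hd b) = length b"
    unfolding least_power_def
  proof (rule Least_equality)
    fix k assume k: "(p ^^ k) (hd b) = hd b \<and> 0 < k"
    hence "b ! (k mod length b) = b ! 0" unfolding pow using assms(2) by (simp add: hd_conv_nth)
    hence "k mod length b = 0" using assms(1,2) by (simp add: nth_eq_iff_index_eq)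
    thus "length b \<le> k" using k by (auto dest: dvd_imp_le)
  qed (use assms(2) in \<open>simp add: pow[of "length b"] hd_conv_nth[symmetric]\<close>)
  thus ?thesis by (intro nth_equalityI) (simp_all add: pow)
qed

text \<open>Every entry of \<open>b\<close> is the head of a rotation of \<open>b\<close>, and \<open>p\<close> acts on the rotation as it
  does on \<open>b\<close>. Hence a cycle can be read from any of its elements.\<close>

lemma set_support:
  assumes "distinct b" "a \<in> set b" and rot: "map p b = rotate1 b"
  shows "set (support p a) = set b"
proof -
  obtain i where i: "i < length b" "b ! i = a" using assms(2) by (metis in_set_conv_nth)
  have "map p (rotate i b) = rotate1 (rotate i b)"
    by (simp add: rotate_map[symmetric] rot rotate1_rotate_swap)
  hence "support p (hd (rotate i b)) = rotate i b"
    using assms by (intro support_hd) auto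
  moreover have "hd (rotate i b) = a" using i by (subst hd_rotate_conv_nth) auto
  ultimately show ?thesis by (metis set_rotate)
qed

definition word :: "nat \<Rightarrow> (nat \<Rightarrow> nat) \<Rightarrow> nat list" where
  "word n \<sigma> = map \<sigma> [1..<Suc n]"

lemma length_word [simp]: "length (word n \<sigma>) = n"
  by (simp add: word_def)

lemma word_nth [simp]: "i < n \<Longrightarrow> word n \<sigma> ! i = \<sigma> (Suc i)"
  by (simp add: word_def del: upt_Suc)

lemma set_upt_Suc: "set [1..<Suc n] = {1..n}"
  by auto

lemma word_perms:
  assumes "\<sigma> \<in> perms n"
  shows "distinct (word n \<sigma>)" "set (word n \<sigma>) = {1..n}"
proof -
  have p: "\<sigma> permutes {1..n}" using assms by (simp add: perms_def)
  show "distinct (word n \<sigma>)"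
    using permutes_inj_on[OF p] by (simp add: word_def distinct_map del: upt_Suc)
  show "set (word n \<sigma>) = {1..n}"
    unfolding word_def set_map set_upt_Suc by (rule permutes_image[OF p])
qed

text \<open>The maximum of a cycle is the head of its block, and the heads of the blocks increase from
  left to right, so the standard cycle notation lists the blocks in their original order.\<close>

lemma std_cycles_cycles_perm:
  assumes d: "distinct w" and s: "set w = {1..n}"
  shows "std_cycles n (cycles_perm (blocks w)) = blocks w"
proof -
  define p where "p = cycles_perm (blocks w)"
  have d': "distinct (concat (blocks w))" using d by simp
  have rot: "map p b = rotate1 b" and db: "distinct b" if "b \<in> set (blocks w)" for b
    using map_cycles_perm_block[OF d' that] d'[unfolded distinct_concat_iff] that by (auto simp: p_def)
  have heads: "a = Max (set (support p a)) \<longleftrightarrow> a \<in> hd ` set (blocks w)" if "a \<in> {1..n}" for a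
  proof -
    have "a \<in> set (concat (blocks w))" using that s by simp
    then obtain b where b: "b \<in> set (blocks w)" "a \<in> set b" unfolding set_concat by blast
    have "Max (set (support p a)) = hd b"
      using set_support[OF db b(2) rot] in_set_blocks(2) b(1) by metis
    moreover have "a = hd b" if "c \<in> set (blocks w)" "a = hd c" for c
    proof -
      have "a \<in> set c" using that in_set_blocks(1) by auto
      hence "c = b" using d'[unfolded distinct_concat_iff] b that(1) by blast
      thus ?thesis using that by simp
    qed
    ultimately show ?thesis using b by auto
  qed
  have "filter (\<lambda>a. a = Max (set (support p a))) [1..<Suc n] = map hd (blocks w)"
  proof (rule strict_sorted_equal)
    show "sorted_wrt (<) (filter (\<lambda>a. a = Max (set (support p a))) [1..<Suc n])"
      by (intro sorted_wrt_filter) (simp del: upt_Suc)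
    have "hd b \<in> set (concat (blocks w))" if "b \<in> set (blocks w)" for b
      using hd_in_set[OF in_set_blocks(1)[OF that]] that unfolding set_concat by blast
    hence "hd ` set (blocks w) \<subseteq> {1..n}" using s by auto
    thus "set (filter (\<lambda>a. a = Max (set (support p a))) [1..<Suc n]) = set (map hd (blocks w))"
      unfolding set_filter set_upt_Suc using heads by auto
    show "sorted_wrt (<) (map hd (blocks w))" by (rule sorted_block_heads[OF d])
  qed
  hence "std_cycles n p = map (support p) (map hd (blocks w))" unfolding std_cycles_def by simp
  also have "\<dots> = map id (blocks w)"
    unfolding map_map
  proof (rule map_cong[OF refl])
    fix b assume b: "b \<in> set (blocks w)"
    show "((support p) \<circ> hd) b = id b" using support_hd[OF db in_set_blocks(1) rot] b by simp
  qed
  finally show ?thesis by (simp add: p_def)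
qed

text \<open>Cutting into blocks is a right inverse of the fundamental bijection by the preceding lemma.
  As \<^term>\<open>perms n\<close> is finite, surjectivity entails injectivity, so it is the inverse.\<close>

lemma hat_eq_cycles_perm:
  assumes "\<sigma> \<in> perms n"
  shows "hat n \<sigma> = cycles_perm (blocks (word n \<sigma>))"
proof -
  let ?h = "\<lambda>\<sigma>. cycles_perm (blocks (word n \<sigma>))"
  have h: "?h \<tau> \<in> perms n" "Phi n (?h \<tau>) = \<tau>" if \<tau>: "\<tau> \<in> perms n" for \<tau>
  proof -
    note w = word_perms[OF \<tau>]
    show "?h \<tau> \<in> perms n"
      using cycles_perm_permutes[of "blocks (word n \<tau>)"] w by (simp add: perms_def)
    show "Phi n (?h \<tau>) = \<tau>"
    proof
      fix i
      show "Phi n (?h \<tau>) i = \<tau> i"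
        using \<tau> std_cycles_cycles_perm[OF w]
        by (auto simp: Phi_def perms_def permutes_def)
    qed
  qed
  have fin: "finite (perms n)" by (simp add: perms_def finite_permutations)
  have "perms n \<subseteq> Phi n ` perms n" using h by (metis imageI subsetI)
  hence "card (Phi n ` perms n) = card (perms n)"
    using fin by (intro antisym card_image_le card_mono) auto
  hence "inj_on (Phi n) (perms n)" by (rule eq_card_imp_inj_on[OF fin])
  hence "hat n (Phi n (?h \<sigma>)) = ?h \<sigma>"
    unfolding hat_def using h(1)[OF assms] by (rule inv_into_f_f)
  thus ?thesis using h(2)[OF assms] by simp
qed

lemma hat_word_nth:
  assumes "\<sigma> \<in> perms n" "i < n"
  shows "hat n \<sigma> (word n \<sigma> ! i) = hat_word (word n \<sigma>) ! i"
proof -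
  have "map (hat n \<sigma>) (word n \<sigma>) = hat_word (word n \<sigma>)"
    using map_cycles_perm_concat[of "blocks (word n \<sigma>)"] word_perms[OF assms(1)]
    by (simp add: hat_eq_cycles_perm[OF assms(1)] hat_word_def)
  thus ?thesis using assms(2) by (metis length_word nth_map)
qed

section \<open>The arrow pattern as a statistic on words\<close>

text \<open>For each letter \<open>x\<close> of the first word, with partner \<open>y\<close> in the second one, the letters to the
  right of \<open>x\<close> with a value strictly between \<open>x\<close> and \<open>y\<close> are counted. Both \<open>\<alpha>\<close> and the number of
  occurrences of 13-2 have this form: the partner is the image of \<open>x\<close> in the first case, and the
  letter after \<open>x\<close> in the second.\<close>

fun between :: "nat list \<Rightarrow> nat list \<Rightarrow> nat" where
  "between (x # w) (y # v) = card {c \<in> set w. x < c \<and> c < y} + between w v"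
| "between _ _ = 0"

lemma between_eq_card:
  "distinct w \<Longrightarrow> length w = length v \<Longrightarrow>
    between w v = card {(i, j). i < j \<and> j < length w \<and> w ! i < w ! j \<and> w ! j < v ! i}"
proof (induction w v rule: between.induct)
  case (1 x w y v)
  let ?P = "\<lambda>w v i j. i < j \<and> j < length w \<and> w ! i < w ! j \<and> w ! j < v ! i"
  let ?A = "{j. j < length w \<and> x < w ! j \<and> w ! j < y}"
  have fin: "finite {(i, j). ?P u v i j}" for u v :: "nat list"
    by (rule finite_subset[of _ "{..<length u} \<times> {..<length u}"]) auto
  have "{(i, j). ?P (x # w) (y # v) i j} =
      (\<lambda>j. (0, Suc j)) ` ?A \<union> map_prod Suc Suc ` {(i, j). ?P w v i j}" (is "?L = ?R")
  proof (intro set_eqI)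
    fix z :: "nat \<times> nat"
    obtain i j where z: "z = (i, j)" by fastforce
    show "z \<in> ?L \<longleftrightarrow> z \<in> ?R"
      by (cases i; cases j) (auto simp: z image_iff)
  qed
  moreover have "card ((\<lambda>j. (0::nat, Suc j)) ` ?A) = card ?A"
    by (rule card_image) (auto simp: inj_on_def)
  moreover have "card (map_prod Suc Suc ` {(i, j). ?P w v i j}) = card {(i, j). ?P w v i j}"
    by (rule card_image) (auto simp: inj_on_def)
  moreover have "card ?A = card {c \<in> set w. x < c \<and> c < y}"
  proof (rule bij_betw_same_card)
    show "bij_betw ((!) w) ?A {c \<in> set w. x < c \<and> c < y}"
      using 1 by (auto simp: bij_betw_def inj_on_def nth_eq_iff_index_eq in_set_conv_nth)
  qed
  moreover have "finite (map_prod Suc Suc ` {(i, j). ?P w v i j})" using fin by blast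
  ultimately show ?case
    using 1 by (subst \<open>?L = ?R\<close>, subst card_Un_disjoint) (auto simp: fin)
qed auto

definition alpha_word :: "nat list \<Rightarrow> nat" where
  "alpha_word w = between w (hat_word w)"

lemma nth_smallest_sorted:
  assumes "X = {a, b, c}" "a < b" "b < (c::nat)"
  shows "nth_smallest X 1 = a" "nth_smallest X 2 = b" "nth_smallest X 3 = c"
proof -
  have "sorted_list_of_set X = [a, b, c]"
    using assms by (intro sorted_list_of_set_unique[THEN iffD1]) auto
  thus "nth_smallest X 1 = a" "nth_smallest X 2 = b" "nth_smallest X 3 = c"
    by (simp_all add: nth_smallest_def)
qed

lemma card_3_sorted:
  assumes "card (X :: nat set) = 3"
  obtains a b c where "X = {a, b, c}" "a < b" "b < c"
proof -
  have fin: "finite X" using assms by (metis card.infinite zero_neq_numeral)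
  have len: "length (sorted_list_of_set X) = 3" using assms by simp
  obtain a b c where abc: "sorted_list_of_set X = [a, b, c]"
  proof -
    have "\<exists>a b c. xs = [a, b, c]" if "length xs = 3" for xs :: "nat list"
      using that by (auto simp: numeral_3_eq_3 length_Suc_conv)
    thus thesis using len that by blast
  qed
  have "sorted_wrt (<) [a, b, c]" unfolding abc[symmetric] by simp
  moreover have "X = {a, b, c}" using fin abc by (metis list.simps(15) empty_set set_sorted_list_of_set)
  ultimately show thesis using that by auto
qed

lemma index_seqs_2: "ts \<in> index_seqs n 2 \<longleftrightarrow> (\<exists>i j. ts = [Suc i, Suc j] \<and> i < j \<and> j < n)"
proof
  assume "ts \<in> index_seqs n 2"
  then obtain a b where "ts = [a, b]" "a < b" "1 \<le> a" "b \<le> n"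
    by (auto simp: index_seqs_def numeral_2_eq_2 length_Suc_conv)
  thus "\<exists>i j. ts = [Suc i, Suc j] \<and> i < j \<and> j < n"
    by (intro exI[of _ "a - 1"] exI[of _ "b - 1"]) auto
qed (auto simp: index_seqs_def)

text \<open>An occurrence \<open>{x\<^sub>1 < x\<^sub>2 < x\<^sub>3}\<close> is determined by the positions of \<open>x\<^sub>1\<close> and \<open>x\<^sub>2\<close> in the word,
  since \<open>x\<^sub>3\<close> is the image of \<open>x\<^sub>1\<close>.\<close>

lemma alpha_eq_alpha_word:
  assumes "\<sigma> \<in> perms n"
  shows "alpha n \<sigma> = alpha_word (word n \<sigma>)"
proof -
  define w where "w = word n \<sigma>"
  define v where "v = hat_word w"
  note wp = word_perms[OF assms, folded w_def]
  have [simp]: "length w = n" "length v = n" by (simp_all add: w_def v_def)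
  have hat: "hat n \<sigma> (w ! i) = v ! i" if "i < n" for i
    using hat_word_nth[OF assms that] by (simp add: w_def v_def)
  have w_nth: "\<sigma> (Suc i) = w ! i" if "i < n" for i using that by (simp add: w_def)
  define P where "P = {(i, j). i < j \<and> j < n \<and> w ! i < w ! j \<and> w ! j < v ! i}"
  define f where "f = (\<lambda>(i, j). {w ! i, w ! j, v ! i})"
  have nths: "nth_smallest (f (i, j)) 1 = w ! i" "nth_smallest (f (i, j)) 2 = w ! j"
      "nth_smallest (f (i, j)) 3 = v ! i" if "(i, j) \<in> P" for i j
    using nth_smallest_sorted[of "f (i, j)" "w ! i" "w ! j" "v ! i"] that
    by (auto simp: P_def f_def)
  have occ: "arrow_occurrences alpha_pattern n \<sigma> = {X. X \<subseteq> {1..n} \<and> card X = 3 \<and>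
      (\<exists>ts \<in> index_seqs n 2. map \<sigma> ts = [nth_smallest X 1, nth_smallest X 2]) \<and>
      hat n \<sigma> (nth_smallest X 1) = nth_smallest X 3}"
    by (simp add: arrow_occurrences_def alpha_pattern_def arrow_size_def numeral_2_eq_2 numeral_3_eq_3)
  have "arrow_occurrences alpha_pattern n \<sigma> = f ` P"
    unfolding occ
  proof (intro equalityI subsetI)
    fix X assume "X \<in> {X. X \<subseteq> {1..n} \<and> card X = 3 \<and>
      (\<exists>ts \<in> index_seqs n 2. map \<sigma> ts = [nth_smallest X 1, nth_smallest X 2]) \<and>
      hat n \<sigma> (nth_smallest X 1) = nth_smallest X 3}"
    hence X: "card X = 3" "\<exists>ts \<in> index_seqs n 2. map \<sigma> ts = [nth_smallest X 1, nth_smallest X 2]"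
      "hat n \<sigma> (nth_smallest X 1) = nth_smallest X 3"
      by blast+
    obtain a b c where abc: "X = {a, b, c}" "a < b" "b < c" using X(1) by (rule card_3_sorted)
    obtain i j where ij: "i < j" "j < n" "w ! i = a" "w ! j = b"
      using X(2) nth_smallest_sorted[OF abc] w_nth by (auto simp: index_seqs_2)
    moreover have "v ! i = c" using hat[of i] X(3) nth_smallest_sorted[OF abc] ij by simp
    ultimately show "X \<in> f ` P" using abc
      by (intro image_eqI[of _ _ "(i, j)"]) (auto simp: P_def f_def)
  next
    fix X assume "X \<in> f ` P"
    then obtain i j where ij: "(i, j) \<in> P" and X: "X = f (i, j)" by auto
    have "set v = set w" by (simp add: v_def)
    hence "X \<subseteq> {1..n}"
      using ij wp(2) nth_mem[of i w] nth_mem[of j w] nth_mem[of i v]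
      by (auto simp: X f_def P_def)
    moreover have "card X = 3" using ij by (auto simp: X f_def P_def)
    moreover have "\<exists>ts \<in> index_seqs n 2. map \<sigma> ts = [nth_smallest X 1, nth_smallest X 2]"
      using ij nths[OF ij] w_nth unfolding X
      by (intro bexI[of _ "[Suc i, Suc j]"]) (auto simp: index_seqs_2 P_def)
    moreover have "hat n \<sigma> (nth_smallest X 1) = nth_smallest X 3"
      using nths[OF ij] hat[of i] ij unfolding X by (auto simp: P_def)
    ultimately show "X \<in> {X. X \<subseteq> {1..n} \<and> card X = 3 \<and>
      (\<exists>ts \<in> index_seqs n 2. map \<sigma> ts = [nth_smallest X 1, nth_smallest X 2]) \<and>
      hat n \<sigma> (nth_smallest X 1) = nth_smallest X 3}"
      by blast
  qed
  moreover have "inj_on f P"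
  proof (rule inj_onI)
    fix z z' assume z: "z \<in> P" "z' \<in> P" "f z = f z'"
    obtain i j i' j' where [simp]: "z = (i, j)" "z' = (i', j')" by fastforce
    have "w ! i = w ! i'" "w ! j = w ! j'"
      using nths[of i j] nths[of i' j'] z by simp_all
    thus "z = z'" using z wp(1) by (auto simp: P_def nth_eq_iff_index_eq)
  qed
  ultimately have "alpha n \<sigma> = card P" by (simp add: alpha_def card_image)
  also have "\<dots> = between w v"
    using between_eq_card[of w v] wp(1) by (simp add: P_def)
  finally show ?thesis by (simp add: alpha_word_def v_def w_def)
qed

text \<open>The number of occurrences of the vincular pattern 13-2. The last letter of \<open>w\<close> has no partner
  in \<^term>\<open>tl w\<close>, which is harmless because nothing stands to its right.\<close>

definition vinc :: "nat list \<Rightarrow> nat" where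
  "vinc w = between w (tl w)"

lemma vinc_Nil [simp]: "vinc [] = 0"
  by (simp add: vinc_def)

lemma vinc_Cons:
  "vinc (x # w) = (if w = [] then 0 else card {c \<in> set w. x < c \<and> c < hd w}) + vinc w"
  by (cases w) (simp_all add: vinc_def)

lemma between_append_split:
  "length u = length u' \<Longrightarrow> between (u @ w) (u' @ w') = between (u @ w) u' + between w w'"
  by (induction u u' rule: list_induct2) simp_all

lemma between_append_irrelevant:
  assumes "length v \<le> length u"
    and "\<And>x y c. x \<in> set u \<Longrightarrow> y \<in> set v \<Longrightarrow> c \<in> set w \<Longrightarrow> \<not> (x < c \<and> c < y)"
  shows "between (u @ w) v = between u v"
  using assms
proof (induction u v rule: between.induct)
  case (1 x u y v)
  have "{c \<in> set (u @ w). x < c \<and> c < y} = {c \<in> set u. x < c \<and> c < y}"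
    using "1.prems"(2) by auto
  moreover have "between (u @ w) v = between u v"
    using "1.prems" by (intro "1.IH") auto
  ultimately show ?case by simp
qed auto

lemma between_append:
  assumes "length u = length u'"
    and "\<And>x y c. x \<in> set u \<Longrightarrow> y \<in> set u' \<Longrightarrow> c \<in> set w \<Longrightarrow> \<not> (x < c \<and> c < y)"
  shows "between (u @ w) (u' @ w') = between u u' + between w w'"
  using between_append_split[OF assms(1), of w w'] between_append_irrelevant[of u' u w] assms
  by simp

text \<open>This is the reason why a single block contributes the number of its occurrences of 13-2 to
  \<open>\<alpha>\<close>: it does not matter which image its last letter has.\<close>

lemma between_tl_snoc: "between w (tl w @ [z]) = vinc w"
proof -
  have "between (x # w) (w @ [z]) = between (x # w) w" for x
    by (induction w arbitrary: x) auto
  thus ?thesis by (cases w) (auto simp: vinc_def)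
qed

lemma vinc_Cons_max:
  assumes "\<And>c. c \<in> set w \<Longrightarrow> c < n"
  shows "vinc (n # w) = vinc w"
proof -
  have "{c \<in> set w. n < c \<and> c < hd w} = {}" using assms by fastforce
  thus ?thesis by (simp only: vinc_Cons card.empty) simp
qed

lemma vinc_append_below:
  assumes "\<And>x c. x \<in> set u \<Longrightarrow> c \<in> set v \<Longrightarrow> c < x"
  shows "vinc (u @ v) = vinc u + vinc v"
  using assms
proof (induction u)
  case (Cons x u)
  have IH: "vinc (u @ v) = vinc u + vinc v" using Cons by simp
  show ?case
  proof (cases u)
    case Nil
    thus ?thesis using vinc_Cons_max[of v x] Cons.prems by (simp add: vinc_Cons)
  next
    case (Cons y u')
    have "{c \<in> set (u @ v). x < c \<and> c < hd (u @ v)} = {c \<in> set u. x < c \<and> c < hd u}"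
      using Cons.prems by (force simp: Cons)
    thus ?thesis using IH by (simp only: append_Cons vinc_Cons) (simp add: Cons)
  qed
qed simp

text \<open>The additional term comes from the last letter of \<open>u\<close> and its successor \<open>n\<close>, between which
  all letters of \<open>v\<close> lie.\<close>

lemma vinc_append_max_above:
  assumes "\<And>x. x \<in> set u \<Longrightarrow> x < n" "\<And>c. c \<in> set v \<Longrightarrow> c < n"
    and "\<And>x c. x \<in> set u \<Longrightarrow> c \<in> set v \<Longrightarrow> x < c" and "distinct v"
  shows "vinc (u @ n # v) = vinc u + vinc v + (if u = [] then 0 else length v)"
  using assms(1,3)
proof (induction u)
  case Nil
  show ?case using vinc_Cons_max[of v n] assms(2) by simp
next
  case (Cons x u)
  show ?case
  proof (cases u)
    case Nil
    have "{c \<in> set (n # v). x < c \<and> c < n} = set v"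
      using Cons.prems assms(2) by auto
    thus ?thesis using vinc_Cons_max[of v n] assms(2) \<open>distinct v\<close>
      by (simp add: Nil vinc_Cons[of x] distinct_card del: set_simps)
  next
    case (Cons y u')
    have "{c \<in> set (u @ n # v). x < c \<and> c < hd (u @ n # v)} = {c \<in> set u. x < c \<and> c < hd u}"
      using Cons.prems by (force simp: Cons)
    thus ?thesis using Cons.IH Cons.prems by (simp only: append_Cons vinc_Cons) (simp add: Cons)
  qed
qed

lemma blocks_append_max:
  assumes "\<And>x. x \<in> set u \<Longrightarrow> x < n" "\<And>c. c \<in> set v \<Longrightarrow> c < n"
  shows "blocks (u @ n # v) = blocks u @ [n # v]"
  using assms(1)
proof (induction u rule: blocks.induct)
  case 1
  have tw: "takeWhile (\<lambda>y. y < n) v = v" and dw: "dropWhile (\<lambda>y. y < n) v = []"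
    using assms(2) by (simp_all add: takeWhile_eq_all_conv dropWhile_eq_Nil_conv)
  show ?case by (simp add: tw dw)
next
  case (2 x w)
  have "\<not> n < x" using 2(2)[of x] by simp
  hence "takeWhile (\<lambda>y. y < x) (w @ n # v) = takeWhile (\<lambda>y. y < x) w"
    "dropWhile (\<lambda>y. y < x) (w @ n # v) = dropWhile (\<lambda>y. y < x) w @ n # v"
    by (simp_all add: takeWhile_tail dropWhile_append3 dropWhile_append)
  moreover have "blocks (dropWhile (\<lambda>y. y < x) w @ n # v) = blocks (dropWhile (\<lambda>y. y < x) w) @ [n # v]"
    using 2 by (intro 2(1)) (auto dest: set_dropWhileD)
  ultimately show ?case by simp
qed

lemma alpha_word_Nil [simp]: "alpha_word [] = 0"
  by (simp add: alpha_word_def)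

text \<open>The maximum \<open>n\<close> opens the last block \<open>n v\<close>. The letters of \<open>u\<close> have their images in \<open>u\<close>, below
  \<open>v\<close> and \<open>n\<close>, so they see nothing to their right outside \<open>u\<close>.\<close>

lemma alpha_word_append_max_above:
  assumes "\<And>x. x \<in> set u \<Longrightarrow> x < n" "\<And>c. c \<in> set v \<Longrightarrow> c < n"
    and "\<And>x c. x \<in> set u \<Longrightarrow> c \<in> set v \<Longrightarrow> x < c"
  shows "alpha_word (u @ n # v) = alpha_word u + vinc v"
proof -
  have "hat_word (u @ n # v) = hat_word u @ (v @ [n])"
    by (simp add: hat_word_def blocks_append_max[OF assms(1,2)])
  moreover have "between (u @ n # v) (hat_word u @ (v @ [n])) =
      between u (hat_word u) + between (n # v) (v @ [n])"
    using assms by (intro between_append) (auto, fastforce+)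
  ultimately show ?thesis
    using between_tl_snoc[of "n # v" n] vinc_Cons_max[of v n] assms(2)
    by (simp add: alpha_word_def)
qed

text \<open>The letter \<open>a\<close> is a block of its own, hence a fixed point.\<close>

lemma alpha_word_Cons_min:
  assumes "\<And>y. y \<in> set u \<Longrightarrow> a < y"
  shows "alpha_word (a # u) = alpha_word u"
proof -
  have "takeWhile (\<lambda>y. y < a) u = [] \<and> dropWhile (\<lambda>y. y < a) u = u"
    using assms by (cases u) (auto dest: less_asym)
  thus ?thesis by (simp add: alpha_word_def hat_word_def)
qed

text \<open>Letters below all of \<open>u\<close> never start a block, so \<open>v\<close> only prolongs the last block of \<open>u\<close>, and
  its letters are too small to lie between a letter of \<open>u\<close> and the image of that letter.
  The induction removes the first block of \<open>u\<close>; the last block is the case \<open>t = []\<close>.\<close>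

lemma alpha_word_append_below:
  assumes "u \<noteq> []" and "\<And>x c. x \<in> set u \<Longrightarrow> c \<in> set v \<Longrightarrow> c < x"
  shows "alpha_word (u @ v) = alpha_word u + vinc v"
  using assms
proof (induction u rule: blocks.induct)
  case (2 x w)
  define s t where "s = takeWhile (\<lambda>y. y < x) w" and "t = dropWhile (\<lambda>y. y < x) w"
  have w: "w = s @ t" by (simp add: s_def t_def)
  have s: "\<And>y. y \<in> set s \<Longrightarrow> y < x" by (auto simp: s_def dest: set_takeWhileD)
  show ?case
  proof (cases "t = []")
    case True
    have "alpha_word (x # w @ v) = vinc (w @ v)"
      using alpha_word_append_max_above[of "[]" x "w @ v"] 2(3) s by (auto simp: w True)
    moreover have "alpha_word (x # w) = vinc w"
      using alpha_word_append_max_above[of "[]" x w] s by (auto simp: w True)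
    moreover have "vinc (w @ v) = vinc w + vinc v"
      using 2(3) by (intro vinc_append_below) auto
    ultimately show ?thesis by simp
  next
    case False
    then obtain z t' where t': "t = z # t'" by (cases t) auto
    have z: "\<not> z < x" using hd_dropWhile[OF False[unfolded t_def], folded t_def] by (simp add: t')
    have b: "blocks (x # w) = (x # s) # blocks t" by (simp add: s_def t_def)
    \<comment> \<open>The first block of \<open>u\<close> is followed by a letter \<open>z\<close> of \<open>u\<close>, so it ends at the same place in
      \<open>u @ v\<close>.\<close>
    have "takeWhile (\<lambda>y. y < x) (s @ z # t' @ v) = s" "dropWhile (\<lambda>y. y < x) (s @ z # t' @ v) = t @ v"
      using z s by (simp_all add: takeWhile_append2 dropWhile_append2 t')
    hence bv: "blocks ((x # w) @ v) = (x # s) # blocks (t @ v)" by (simp add: w t')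
    have IH: "alpha_word (t @ v) = alpha_word t + vinc v"
      by (rule 2(1)[folded t_def, OF False]) (use 2(3) in \<open>simp add: w\<close>)
    have split: "between (x # s @ u) (s @ x # u') = between (x # s @ u) (s @ [x]) + between u u'"
      for u u' using between_append_split[of "x # s" "s @ [x]" u u'] by simp
    have "between ((x # s @ t) @ v) (s @ [x]) = between (x # s @ t) (s @ [x])"
      using 2(3) by (intro between_append_irrelevant) (auto simp: w dest: less_asym)
    hence drop_v: "between (x # s @ t @ v) (s @ [x]) = between (x # s @ t) (s @ [x])" by simp
    have "alpha_word ((x # w) @ v) = between (x # s @ t @ v) (s @ x # hat_word (t @ v))"
      unfolding alpha_word_def hat_word_def bv by (simp add: w)
    also have "\<dots> = between (x # s @ t @ v) (s @ [x]) + alpha_word (t @ v)"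
      unfolding alpha_word_def by (rule split)
    also have "between (x # s @ t @ v) (s @ [x]) = between (x # s @ t) (s @ [x])"
      by (rule drop_v)
    also have "\<dots> + alpha_word (t @ v) = alpha_word (x # w) + vinc v"
    proof -
      have "alpha_word (x # w) = between (x # s @ t) (s @ x # hat_word t)"
        unfolding alpha_word_def hat_word_def b by (simp add: w)
      also have "\<dots> = between (x # s @ t) (s @ [x]) + alpha_word t"
        unfolding alpha_word_def by (rule split)
      finally show ?thesis using IH by simp
    qed
    finally show ?thesis .
  qed
qed simp

section \<open>Permutations avoiding a pattern of length three as binary trees\<close>

text \<open>The ternary analogue of \<^const>\<open>sorted_wrt\<close>. It expresses the avoidance of a pattern of length
  three in a form that splits along concatenations (\<open>triplewise_append\<close>).\<close>

primrec triplewise :: "('a \<Rightarrow> 'a \<Rightarrow> 'a \<Rightarrow> bool) \<Rightarrow> 'a list \<Rightarrow> bool" where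
  "triplewise P [] = True"
| "triplewise P (x # w) = (sorted_wrt (P x) w \<and> triplewise P w)"

lemma triplewise_iff_nth:
  "triplewise P w \<longleftrightarrow>
    (\<forall>i j k. i < j \<longrightarrow> j < k \<longrightarrow> k < length w \<longrightarrow> P (w ! i) (w ! j) (w ! k))"
proof (induction w)
  case (Cons x w)
  show ?case
    unfolding triplewise.simps Cons.IH sorted_wrt_iff_nth_less
    by (auto simp: nth_Cons split: nat.split)
qed simp

lemma triplewise_append:
  "triplewise P (u @ v) \<longleftrightarrow> triplewise P u \<and> triplewise P v \<and>
    (\<forall>x \<in> set u. sorted_wrt (P x) v) \<and> sorted_wrt (\<lambda>x y. \<forall>z \<in> set v. P x y z) u"
  by (induction u) (auto simp: sorted_wrt_append)

abbreviation avoids213 :: "nat list \<Rightarrow> bool" where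
  "avoids213 \<equiv> triplewise (\<lambda>x y z. \<not> (y < x \<and> x < z))"

abbreviation avoids231 :: "nat list \<Rightarrow> bool" where
  "avoids231 \<equiv> triplewise (\<lambda>x y z. \<not> (z < x \<and> x < y))"

lemma sorted_wrt_trivial: "(\<And>x y. x \<in> set w \<Longrightarrow> y \<in> set w \<Longrightarrow> P x y) \<Longrightarrow> sorted_wrt P w"
  by (induction w) auto

lemma index_seqs_3:
  "ts \<in> index_seqs n 3 \<longleftrightarrow> (\<exists>i j k. ts = [Suc i, Suc j, Suc k] \<and> i < j \<and> j < k \<and> k < n)"
proof
  assume "ts \<in> index_seqs n 3"
  then obtain a b c where "ts = [a, b, c]" "a < b" "b < c" "1 \<le> a" "c \<le> n"
    by (auto simp: index_seqs_def numeral_3_eq_3 length_Suc_conv)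
  thus "\<exists>i j k. ts = [Suc i, Suc j, Suc k] \<and> i < j \<and> j < k \<and> k < n"
    by (intro exI[of _ "a - 1"] exI[of _ "b - 1"] exI[of _ "c - 1"]) auto
qed (auto simp: index_seqs_def)

lemma contains_length_3:
  assumes "length p = 3"
  shows "contains n \<sigma> p \<longleftrightarrow> (\<exists>i j k. i < j \<and> j < k \<and> k < n \<and>
    (\<forall>a < 3. \<forall>b < 3. map ((!) (word n \<sigma>)) [i, j, k] ! a < map ((!) (word n \<sigma>)) [i, j, k] ! b \<longleftrightarrow>
      p ! a < p ! b))"
proof -
  have nth: "\<sigma> ([Suc i, Suc j, Suc k] ! a) = map ((!) (word n \<sigma>)) [i, j, k] ! a"
    if "i < j" "j < k" "k < n" "a < 3" for i j k a
    using that by (auto simp: less_Suc_eq numeral_3_eq_3)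
  have "contains n \<sigma> p \<longleftrightarrow> (\<exists>i j k. i < j \<and> j < k \<and> k < n \<and>
    (\<forall>a < 3. \<forall>b < 3. \<sigma> ([Suc i, Suc j, Suc k] ! a) < \<sigma> ([Suc i, Suc j, Suc k] ! b) \<longleftrightarrow>
      p ! a < p ! b))"
    unfolding contains_def assms Bex_def index_seqs_3 by blast
  also have "\<dots> \<longleftrightarrow> (\<exists>i j k. i < j \<and> j < k \<and> k < n \<and>
    (\<forall>a < 3. \<forall>b < 3. map ((!) (word n \<sigma>)) [i, j, k] ! a < map ((!) (word n \<sigma>)) [i, j, k] ! b \<longleftrightarrow>
      p ! a < p ! b))"
    by (intro ex_cong1 conj_cong refl all_cong) (simp only: nth)
  finally show ?thesis .
qed

lemma all_less_3: "(\<forall>a < (3::nat). Q a) \<longleftrightarrow> Q 0 \<and> Q 1 \<and> Q 2"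
  by (auto simp: numeral_3_eq_3 numeral_2_eq_2 less_Suc_eq)

lemma order_isomorphic_213:
  "(\<forall>a < 3. \<forall>b < 3. [x, y, z] ! a < [x, y, z] ! b \<longleftrightarrow> [2, 1, 3 :: nat] ! a < [2, 1, 3] ! b) \<longleftrightarrow>
    y < x \<and> x < (z :: nat)"
  by (auto simp: all_less_3)

lemma order_isomorphic_231:
  "(\<forall>a < 3. \<forall>b < 3. [x, y, z] ! a < [x, y, z] ! b \<longleftrightarrow> [2, 3, 1 :: nat] ! a < [2, 3, 1] ! b) \<longleftrightarrow>
    z < x \<and> x < (y :: nat)"
  by (auto simp: all_less_3)

lemma contains_213: "contains n \<sigma> [2,1,3] \<longleftrightarrow> \<not> avoids213 (word n \<sigma>)"
proof -
  have "length [2, 1, 3 :: nat] = 3" by simp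
  thus ?thesis
    by (simp only: contains_length_3 list.map order_isomorphic_213 triplewise_iff_nth length_word) blast
qed

lemma contains_231: "contains n \<sigma> [2,3,1] \<longleftrightarrow> \<not> avoids231 (word n \<sigma>)"
proof -
  have "length [2, 3, 1 :: nat] = 3" by simp
  thus ?thesis
    by (simp only: contains_length_3 list.map order_isomorphic_231 triplewise_iff_nth length_word) blast
qed

lemma bij_betw_word:
  "bij_betw (word n) (perms n) {w. distinct w \<and> set w = {1..n}}"
proof (rule bij_betw_byWitness)
  let ?g = "\<lambda>w i. if i \<in> {1..n} then w ! (i - 1) else (i :: nat)"
  have len: "length w = n" if "distinct w" "set w = {1..n}" for w
    using that distinct_card by fastforce
  show "\<forall>\<sigma> \<in> perms n. ?g (word n \<sigma>) = \<sigma>"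
    by (auto simp: perms_def permutes_def fun_eq_iff)
  show "\<forall>w \<in> {w. distinct w \<and> set w = {1..n}}. word n (?g w) = w"
    by (auto simp: len intro!: nth_equalityI)
  show "word n ` perms n \<subseteq> {w. distinct w \<and> set w = {1..n}}"
    using word_perms by auto
  show "?g ` {w. distinct w \<and> set w = {1..n}} \<subseteq> perms n"
  proof clarify
    fix w assume w: "distinct w" "set w = {1..n}"
    have l: "length w = n" using w by (rule len)
    have "bij_betw (?g w) {1..n} {1..n}"
    proof (rule bij_betw_imageI)
      show "inj_on (?g w) {1..n}"
        using w l by (auto simp: inj_on_def nth_eq_iff_index_eq)
      have "?g w ` {1..n} = (!) w ` {..<n}"
        unfolding image_Suc_lessThan[symmetric] image_image by (intro image_cong) auto
      also have "\<dots> = set w" using l by (auto simp: set_conv_nth)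
      finally show "?g w ` {1..n} = {1..n}" using w by simp
    qed
    thus "?g w \<in> perms n" unfolding perms_def by (auto intro: bij_imp_permutes)
  qed
qed

text \<open>A tree of size \<open>n\<close> encodes a word on the letters \<open>k + 1, \<dots>, k + n\<close>. For 213 the root is the first
  letter, the left subtree encodes the larger letters and the right subtree the smaller ones. For
  231 the root is the maximum, and the left subtree encodes the letters in front of it, which are
  the smaller ones.\<close>

primrec word213 :: "nat \<Rightarrow> unit tree \<Rightarrow> nat list" where
  "word213 k \<langle>\<rangle> = []"
| "word213 k \<langle>u, x, d\<rangle> = (k + size d + 1) # word213 (k + size d + 1) u @ word213 k d"

primrec word231 :: "nat \<Rightarrow> unit tree \<Rightarrow> nat list" where
  "word231 k \<langle>\<rangle> = []"
| "word231 k \<langle>l, x, r\<rangle> = word231 k l @ (k + size l + size r + 1) # word231 (k + size l) r"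

lemma set_word213 [simp]: "set (word213 k t) = {k<..k + size t}"
  by (induction t arbitrary: k) auto

lemma set_word231 [simp]: "set (word231 k t) = {k<..k + size t}"
  by (induction t arbitrary: k) auto

lemma length_word213 [simp]: "length (word213 k t) = size t"
  by (induction t arbitrary: k) auto

lemma length_word231 [simp]: "length (word231 k t) = size t"
  by (induction t arbitrary: k) auto

lemma distinct_word213 [simp]: "distinct (word213 k t)"
  by (rule card_distinct) simp

lemma distinct_word231 [simp]: "distinct (word231 k t)"
  by (rule card_distinct) simp

lemma avoids_word213: "avoids213 (word213 k t)"
proof (induction t arbitrary: k)
  case (Node u x d)
  show ?case
    using Node by (auto simp: triplewise_append sorted_wrt_append intro!: sorted_wrt_trivial)
qed simp

lemma avoids_word231: "avoids231 (word231 k t)"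
proof (induction t arbitrary: k)
  case (Node l x r)
  show ?case
    using Node by (auto simp: triplewise_append sorted_wrt_append intro!: sorted_wrt_trivial)
qed simp

lemma inj_word213: "word213 k t = word213 k t' \<Longrightarrow> t = t'"
proof (induction t arbitrary: k t')
  case Leaf
  thus ?case by (cases t') auto
next
  case (Node u x d)
  then obtain u' x' d' where t': "t' = \<langle>u', x', d'\<rangle>" by (cases t') auto
  have d: "size d = size d'" using Node.prems by (simp add: t')
  have "length (word213 k \<langle>u, x, d\<rangle>) = length (word213 k t')" using Node.prems by simp
  hence u: "size u = size u'" unfolding length_word213 using d by (simp add: t')
  have "word213 (k + size d + 1) u = word213 (k + size d + 1) u' \<and> word213 k d = word213 k d'"
    using Node.prems d u by (simp add: t')
  thus ?case using Node.IH by (auto simp: t')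
qed

lemma inj_word231: "word231 k t = word231 k t' \<Longrightarrow> t = t'"
proof (induction t arbitrary: k t')
  case Leaf
  thus ?case by (cases t') auto
next
  case (Node l x r)
  then obtain l' x' r' where t': "t' = \<langle>l', x', r'\<rangle>" by (cases t') auto
  define m where "m = k + size l + size r + 1"
  have "length (word231 k \<langle>l, x, r\<rangle>) = length (word231 k t')" using Node.prems by simp
  hence m': "k + size l' + size r' + 1 = m" unfolding length_word231 by (simp add: t' m_def)
  have "word231 k l @ m # word231 (k + size l) r = word231 k l' @ m # word231 (k + size l') r'"
    using Node.prems m' by (simp add: t' m_def)
  hence eq: "word231 k l = word231 k l' \<and> word231 (k + size l) r = word231 (k + size l') r'"
    using m' by (subst (asm) append_Cons_eq_iff) (auto simp: m_def)
  hence "l = l'" using Node.IH(1) by blast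
  thus ?case using eq Node.IH(2) by (auto simp: t')
qed

text \<open>This replaces standardization: the subwords in the two decompositions below are again words on
  intervals, so they are encoded by trees with a suitable offset.\<close>

lemma interval_split:
  fixes A B :: "nat set"
  assumes un: "A \<union> B = {k<..k + n}" and AB: "\<forall>a \<in> A. \<forall>b \<in> B. a < b"
  shows "A = {k<..k + card A}" "B = {k + card A<..k + n}"
proof -
  have fin: "finite A" "finite B" using un by (metis finite_Un finite_greaterThanAtMost)+
  have disj: "A \<inter> B = {}" using AB by fastforce
  define m where "m = (if A = {} then k else Max A)"
  have m: "A \<subseteq> {..m}" "k \<le> m" "m \<le> k + n" "A = {} \<or> m \<in> A"
  proof -
    have "Max A \<in> A" if "A \<noteq> {}" using fin that by simp
    moreover from this have "Max A \<in> {k<..k + n}" if "A \<noteq> {}" using un that by blast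
    ultimately show "A \<subseteq> {..m}" "k \<le> m" "m \<le> k + n" "A = {} \<or> m \<in> A"
      using fin by (cases "A = {}"; auto simp: m_def)+
  qed
  have "A = {k<..m}"
  proof (intro equalityI subsetI)
    fix x assume x: "x \<in> {k<..m}"
    hence "A \<noteq> {}" by (auto simp: m_def)
    hence "m \<in> A" using m by auto
    moreover have "x \<in> A \<union> B" using x m un by auto
    ultimately show "x \<in> A" using AB x by (meson UnE greaterThanAtMost_iff leD)
  qed (use m un in auto)
  moreover from this have "card A = m - k" by simp
  ultimately show A: "A = {k<..k + card A}" using m by simp
  have "B = {k<..k + n} - A" using un disj by auto
  thus "B = {k + card A<..k + n}" by (subst (asm) A) auto
qed

text \<open>The second assumption says that \<open>a\<close> is not the 2 of a pattern 213, so that no larger letter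
  follows a smaller one.\<close>

lemma split_at_pivot:
  assumes "distinct (a # w)" and "sorted_wrt (\<lambda>y z. \<not> (y < a \<and> a < z)) w"
  obtains u d where "w = u @ d" "\<forall>y \<in> set u. a < y" "\<forall>y \<in> set d. y < (a::nat)"
proof -
  have "w = filter (\<lambda>y. a < y) w @ filter (\<lambda>y. y < a) w"
    using assms
  proof (induction w)
    case (Cons b w)
    show ?case
    proof (cases "b < a")
      case True
      hence "\<forall>z \<in> set w. z < a"
        using Cons.prems
        by (metis distinct_length_2_or_more distinct.simps(2) list.set_intros(2) nat_neq_iff sorted_wrt.simps(2))
      hence "filter (\<lambda>y. a < y) w = []" "filter (\<lambda>y. y < a) w = w"
        by (auto simp: filter_empty_conv intro: filter_True)
      thus ?thesis using True by simp
    next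
      case False
      thus ?thesis using Cons by auto
    qed
  qed simp
  thus thesis by (rule that) auto
qed

lemma ex_word213:
  "distinct w \<Longrightarrow> set w = {k<..k + n} \<Longrightarrow> avoids213 w \<Longrightarrow> \<exists>t. size t = n \<and> w = word213 k t"
proof (induction n arbitrary: w k rule: less_induct)
  case (less n)
  show ?case
  proof (cases w)
    case Nil
    thus ?thesis using less.prems by (intro exI[of _ "\<langle>\<rangle>"]) auto
  next
    case (Cons a v)
    obtain u d where v: "v = u @ d" "\<forall>y \<in> set u. a < y" "\<forall>y \<in> set d. y < a"
      using split_at_pivot[of a v] less.prems by (auto simp: Cons)
    have dist: "distinct u" "distinct d" using less.prems by (auto simp: Cons v)
    have av: "avoids213 u" "avoids213 d" using less.prems by (auto simp: Cons v triplewise_append)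
    have un: "set d \<union> ({a} \<union> set u) = {k<..k + n}" using less.prems by (auto simp: Cons v)
    have "\<forall>b \<in> set d. \<forall>c \<in> {a} \<union> set u. b < c"
      using v by force
    note d = interval_split[OF un this, unfolded distinct_card[OF dist(2)]]
    have len: "length d + length u + 1 = n"
    proof -
      have "length w = card {k<..k + n}" using less.prems distinct_card by metis
      thus ?thesis by (simp add: Cons v)
    qed
    have un': "{a} \<union> set u = {k + length d<..(k + length d) + (length u + 1)}"
    proof -
      have "k + n = (k + length d) + (length u + 1)" using len by simp
      thus ?thesis using d(2) by (simp only:)
    qed
    have "\<forall>b \<in> {a}. \<forall>c \<in> set u. b < c"
      using v by auto
    note au = interval_split[OF un' this]
    have "a \<in> {k + length d<..k + length d + 1}"
      using au(1) by (metis insertI1 is_singletonI is_singleton_altdef)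
    hence a': "a = k + length d + 1" by simp
    have u: "set u = {k + length d + 1<..(k + length d) + (length u + 1)}"
      using au(2) by simp
    obtain s where s: "size s = length u" "u = word213 (k + length d + 1) s"
      using less.IH[of "length u" u "k + length d + 1"] dist av u len by auto
    obtain t where t: "size t = length d" "d = word213 k t"
      using less.IH[of "length d" d k] dist av d len by auto
    show ?thesis
    proof (intro exI[of _ "\<langle>s, (), t\<rangle>"] conjI)
      show "w = word213 k \<langle>s, (), t\<rangle>"
        unfolding word213.simps Cons v(1) t(1) s(2)[symmetric] t(2)[symmetric] a' ..
      show "size \<langle>s, (), t\<rangle> = n" using s(1) t(1) len by simp
    qed
  qed
qed

text \<open>The letters in front of the maximum are smaller than those behind it, since otherwise the
  maximum would be the 3 of a pattern 231.\<close>

lemma ex_word231: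
  "distinct w \<Longrightarrow> set w = {k<..k + n} \<Longrightarrow> avoids231 w \<Longrightarrow> \<exists>t. size t = n \<and> w = word231 k t"
proof (induction n arbitrary: w k rule: less_induct)
  case (less n)
  show ?case
  proof (cases "n = 0")
    case True
    thus ?thesis using less.prems by (intro exI[of _ "\<langle>\<rangle>"]) auto
  next
    case False
    hence "k + n \<in> set w" using less.prems by auto
    then obtain u v where w: "w = u @ (k + n) # v" by (meson split_list)
    have dist: "distinct u" "distinct v" using less.prems by (auto simp: w)
    have av: "avoids231 u" "avoids231 v" using less.prems by (auto simp: w triplewise_append)
    have un: "set u \<union> set v = {k<..k + (n - 1)}"
    proof -
      have "set u \<union> set v = set w - {k + n}" using less.prems(1) by (auto simp: w)
      also have "\<dots> = {k<..k + (n - 1)}" unfolding less.prems(2) using False by auto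
      finally show ?thesis .
    qed
    have "\<forall>a \<in> set u. \<forall>b \<in> set v. a < b"
    proof (intro ballI)
      fix a b assume that: "a \<in> set u" "b \<in> set v"
      have "\<not> (b < a \<and> a < k + n)" using less.prems(3) that by (auto simp: w triplewise_append)
      moreover have "a < k + n"
      proof -
        have "a \<in> {k<..k + (n - 1)}" using un that by blast
        thus ?thesis using False by auto
      qed
      moreover have "a \<noteq> b" using less.prems(1) that by (auto simp: w)
      ultimately show "a < b" by simp
    qed
    note sp = interval_split[OF un this]
    have len: "length u + length v + 1 = n"
    proof -
      have "length w = card {k<..k + n}" using less.prems distinct_card by metis
      thus ?thesis by (simp add: w)
    qed
    have u: "set u = {k<..k + length u}" and v: "set v = {k + length u<..(k + length u) + length v}"
    proof -
      have kn: "k + (n - 1) = (k + length u) + length v" using len by simp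
      show "set u = {k<..k + length u}" "set v = {k + length u<..(k + length u) + length v}"
        using sp unfolding distinct_card[OF dist(1)] kn .
    qed
    obtain s where s: "size s = length u" "u = word231 k s"
      using less.IH[of "length u" u k] dist av u len by auto
    obtain t where t: "size t = length v" "v = word231 (k + length u) t"
      using less.IH[of "length v" v "k + length u"] dist av v len by auto
    show ?thesis
    proof (intro exI[of _ "\<langle>s, (), t\<rangle>"] conjI)
      have "k + n = k + size s + size t + 1" using s(1) t(1) len by simp
      thus "w = word231 k \<langle>s, (), t\<rangle>"
        unfolding word231.simps w s(1) s(2)[symmetric] t(2)[symmetric] by simp
      show "size \<langle>s, (), t\<rangle> = n" using s(1) t(1) len by simp
    qed
  qed
qed

lemma greaterThanAtMost_0: "{0<..n} = {1..n::nat}"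
  by auto

lemma bij_betw_word213:
  "bij_betw (word213 0) {t. size t = n} {w. distinct w \<and> set w = {1..n} \<and> avoids213 w}"
proof (rule bij_betw_imageI)
  show "inj_on (word213 0) {t. size t = n}" by (auto intro: inj_onI inj_word213)
  show "word213 0 ` {t. size t = n} = {w. distinct w \<and> set w = {1..n} \<and> avoids213 w}"
    using ex_word213[of _ 0 n] avoids_word213[of 0]
    by (auto simp: greaterThanAtMost_0 image_iff)
qed

lemma bij_betw_word231:
  "bij_betw (word231 0) {t. size t = n} {w. distinct w \<and> set w = {1..n} \<and> avoids231 w}"
proof (rule bij_betw_imageI)
  show "inj_on (word231 0) {t. size t = n}" by (auto intro: inj_onI inj_word231)
  show "word231 0 ` {t. size t = n} = {w. distinct w \<and> set w = {1..n} \<and> avoids231 w}"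
    using ex_word231[of _ 0 n] avoids_word231[of 0]
    by (auto simp: greaterThanAtMost_0 image_iff)
qed

text \<open>The statistics \<^const>\<open>vinc\<close> and \<^const>\<open>alpha_word\<close> of the words of a tree. They do not depend on
  the offset \<open>k\<close>.\<close>

fun vinc213 :: "'a tree \<Rightarrow> nat" where
  "vinc213 \<langle>\<rangle> = 0"
| "vinc213 \<langle>u, _, d\<rangle> = vinc213 u + vinc213 d + (if u = \<langle>\<rangle> then 0 else size (right u))"

fun alpha213 :: "'a tree \<Rightarrow> nat" where
  "alpha213 \<langle>\<rangle> = 0"
| "alpha213 \<langle>u, _, d\<rangle> = alpha213 u + vinc213 d"

fun vinc231 :: "'a tree \<Rightarrow> nat" where
  "vinc231 \<langle>\<rangle> = 0"
| "vinc231 \<langle>l, _, r\<rangle> = vinc231 l + vinc231 r + (if l = \<langle>\<rangle> then 0 else size r)"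

fun alpha231 :: "'a tree \<Rightarrow> nat" where
  "alpha231 \<langle>\<rangle> = 0"
| "alpha231 \<langle>l, _, r\<rangle> = alpha231 l + vinc231 r"

text \<open>If \<open>u\<close> is not empty, the letters between the root and the first letter of \<open>u\<close> are those of the
  right subtree of \<open>u\<close>.\<close>

lemma vinc_word213: "vinc (word213 k t) = vinc213 t"
proof (induction t arbitrary: k)
  case (Node u x d)
  define m where "m = k + size d + 1"
  define w where "w = word213 m u @ word213 k d"
  have w: "vinc w = vinc213 u + vinc213 d"
    unfolding w_def using Node by (subst vinc_append_below) (auto simp: m_def)
  have "vinc (word213 k \<langle>u, x, d\<rangle>) = vinc (m # w)" by (simp add: m_def w_def)
  also have "\<dots> = vinc w + (if u = \<langle>\<rangle> then 0 else size (right u))"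
  proof (cases u)
    case Leaf
    thus ?thesis using vinc_Cons_max[of w m] by (auto simp: w_def m_def)
  next
    case (Node u' y d')
    have "{c \<in> set w. m < c \<and> c < hd w} = {m<..<m + size d' + 1}"
      by (auto simp: w_def Node m_def)
    moreover have "w \<noteq> []" by (simp add: w_def Node)
    ultimately show ?thesis unfolding vinc_Cons by (simp add: Node)
  qed
  finally show ?case using w by simp
qed simp

lemma vinc_word231: "vinc (word231 k t) = vinc231 t"
proof (induction t arbitrary: k)
  case (Node l x r)
  show ?case unfolding word231.simps
    using Node by (subst vinc_append_max_above) (auto simp flip: length_0_conv)
qed simp

lemma alpha_word231: "alpha_word (word231 k t) = alpha231 t"
proof (induction t arbitrary: k)
  case (Node l x r)
  show ?case unfolding word231.simps
    using Node by (subst alpha_word_append_max_above) (auto simp: vinc_word231)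
qed simp

lemma alpha_word213: "alpha_word (word213 k t) = alpha213 t"
proof (induction t arbitrary: k)
  case (Node u x d)
  define m where "m = k + size d + 1"
  have "alpha_word ((m # word213 m u) @ word213 k d) =
      alpha_word (m # word213 m u) + vinc (word213 k d)"
    by (rule alpha_word_append_below) (auto simp: m_def)
  moreover have "alpha_word (m # word213 m u) = alpha_word (word213 m u)"
    by (rule alpha_word_Cons_min) auto
  ultimately show ?case using Node by (simp add: m_def vinc_word213)
qed simp

text \<open>Any encoding \<open>h\<close> of avoiding words by trees transports the distribution of \<open>\<alpha>\<close>; the two
  patterns are the two instances below.\<close>

lemma sum_avoiders:
  fixes g :: "nat \<Rightarrow> 'b :: comm_monoid_add"
  assumes "\<And>\<sigma>. contains n \<sigma> p \<longleftrightarrow> \<not> A (word n \<sigma>)"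
    and "bij_betw h {t :: unit tree. size t = n} {w. distinct w \<and> set w = {1..n} \<and> A w}"
    and "\<And>t. alpha_word (h t) = f t"
  shows "(\<Sum>\<sigma> \<in> avoiders n p. g (alpha n \<sigma>)) = (\<Sum>t | size t = n. g (f t))"
proof -
  let ?W = "{w. distinct w \<and> set w = {1..n} \<and> A w}"
  have "bij_betw (word n) (avoiders n p) ?W"
    using bij_betw_word[of n] unfolding avoiders_def assms(1)
    by (auto simp: bij_betw_def intro: inj_on_subset)
  have "(\<Sum>\<sigma> \<in> avoiders n p. g (alpha n \<sigma>)) = (\<Sum>\<sigma> \<in> avoiders n p. g (alpha_word (word n \<sigma>)))"
    by (rule sum.cong) (auto simp: avoiders_def alpha_eq_alpha_word)
  also have "\<dots> = (\<Sum>w \<in> ?W. g (alpha_word w))"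
    by (rule sum.reindex_bij_betw) fact
  also have "\<dots> = (\<Sum>t | size t = n. g (alpha_word (h t)))"
    by (rule sum.reindex_bij_betw[symmetric]) fact
  finally show ?thesis by (simp add: assms(3))
qed

lemmas sum_avoiders213 = sum_avoiders[OF contains_213 bij_betw_word213 alpha_word213]
lemmas sum_avoiders231 = sum_avoiders[OF contains_231 bij_betw_word231 alpha_word231]

section \<open>The continued fraction and the generating functions of trees\<close>

lemma fps_recip_unique:
  assumes "f * g = (1 :: 'a::comm_ring_1 fps)" and "f $ 0 = 1"
  shows "g = fps_recip f"
proof -
  have "g = g * (f * fps_recip f)" using fps_recip[OF assms(2)] by simp
  also have "\<dots> = (f * g) * fps_recip f" by (simp add: mult_ac)
  finally show ?thesis using assms(1) by simp
qed

text \<open>If \<open>F\<^sub>k = 1 / (1 - c\<^sub>k F\<^sub>k\<^sub>+\<^sub>1)\<close> for all \<open>k\<close>, then \<open>F\<^sub>0\<close> is the finite continued fraction in which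
  the innermost 1 is replaced by \<open>F\<^sub>N\<close>. Each level is divisible by \<open>x\<close> and so removes the error up
  to one further order.\<close>

lemma convergent_cf_approximates_tail:
  fixes F c :: "nat \<Rightarrow> 'a::comm_ring_1 fps"
  assumes "\<And>k. fps_X dvd c k" and "\<And>k. F k * (1 - c k * F (Suc k)) = 1"
  shows "fps_X ^ N dvd F 0 - convergent_cf N c"
  using assms
proof (induction N arbitrary: F c)
  case 0
  then show ?case by simp
next
  case (Suc N)
  define P where "P = convergent_cf N (\<lambda>k. c (Suc k))"
  obtain d where d: "c 0 = fps_X * d" using Suc.prems(1)[of 0] by (auto elim: dvdE)
  have P: "(1 - c 0 * P) * fps_recip (1 - c 0 * P) = 1"
    by (rule fps_recip) (simp add: d)
  have F: "F 0 * (1 - c 0 * F 1) = 1" using Suc.prems(2)[of 0] by simp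
  have "F 0 - fps_recip (1 - c 0 * P) =
      F 0 * ((1 - c 0 * P) * fps_recip (1 - c 0 * P)) -
      (F 0 * (1 - c 0 * F 1)) * fps_recip (1 - c 0 * P)"
    by (simp only: P F mult_1 mult_1_right)
  also have "\<dots> = (c 0 * (F 1 - P)) * (F 0 * fps_recip (1 - c 0 * P))"
    by (simp add: algebra_simps)
  finally have eq: "F 0 - fps_recip (1 - c 0 * P) = \<dots>" .
  have "fps_X ^ N dvd F 1 - P"
    unfolding P_def using Suc.IH[of "\<lambda>k. c (Suc k)" "\<lambda>k. F (Suc k)"] Suc.prems by simp
  hence "fps_X * fps_X ^ N dvd c 0 * (F 1 - P)"
    by (intro mult_dvd_mono Suc.prems)
  thus ?case unfolding P_def[symmetric] convergent_cf.simps eq by (simp add: dvd_mult2)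
qed

lemma C_eqI:
  fixes F :: "nat \<Rightarrow> 'a::comm_ring_1 fps"
  assumes "\<And>k. F k * (1 - C_numerator t q k * F (Suc k)) = 1"
  shows "C t q = F 0"
proof -
  let ?P = "\<lambda>N. convergent_cf N (C_numerator t q)"
  have "?P \<longlonglongrightarrow> F 0"
  proof (rule tendsto_fpsI)
    fix n
    have "?P N $ n = F 0 $ n" if "N > n" for N
    proof -
      have "fps_X ^ N dvd F 0 - ?P N"
        by (rule convergent_cf_approximates_tail[of "C_numerator t q" F, OF _ assms]) (simp add: C_numerator_def)
      then obtain h where "F 0 - ?P N = fps_X ^ N * h" by (auto elim: dvdE)
      hence "(F 0 - ?P N) $ n = 0" using that by (simp add: fps_X_power_mult_nth)
      thus ?thesis by simp
    qed
    thus "\<forall>\<^sub>F N in sequentially. ?P N $ n = F 0 $ n"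
      by (rule eventually_mono[OF eventually_gt_at_top[of n]])
  qed
  thus ?thesis by (rule LIMSEQ_unique[OF C_convergents])
qed

definition dilate :: "'a::comm_ring_1 \<Rightarrow> 'a fps \<Rightarrow> 'a fps" where
  "dilate q F = F oo (fps_const q * fps_X)"

lemma dilate_nth [simp]: "dilate q F $ n = q ^ n * F $ n"
  by (simp add: dilate_def fps_compose_linear)

lemma dilate_dilate: "dilate p (dilate q F) = dilate (p * q) F"
  by (simp add: fps_eq_iff power_mult_distrib mult_ac)

lemma dilate_relation:
  fixes F G :: "'a::idom fps"
  assumes "F * (1 - fps_X * G) = 1"
  shows "dilate q F * (1 - fps_const q * fps_X * dilate q G) = 1"
proof -
  have "dilate q (F * (1 - fps_X * G)) = dilate q F * (1 - fps_const q * fps_X * dilate q G)"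
    by (simp add: dilate_def fps_compose_mult_distrib fps_compose_sub_distrib)
  moreover have "dilate q (1 :: 'a fps) = 1" by (simp add: dilate_def)
  ultimately show ?thesis using assms by simp
qed

text \<open>The levels \<open>2k\<close> and \<open>2k + 1\<close> of the continued fraction have the values \<open>F(q\<^sup>k x)\<close> and
  \<open>G(q\<^sup>k x)\<close>.\<close>

lemma C_one_eqI:
  fixes F G :: "'a::idom fps"
  assumes F: "F * (1 - fps_X * G) = 1" and G: "G * (1 - fps_X * dilate q F) = 1"
  shows "C 1 q = F"
proof -
  define T where "T k = (if even k then dilate (q ^ (k div 2)) F else dilate (q ^ (k div 2)) G)" for k
  have "T k * (1 - C_numerator 1 q k * T (Suc k)) = 1" for k
  proof (cases "even k")
    case True
    then show ?thesis using dilate_relation[OF F] by (simp add: T_def C_numerator_def)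
  next
    case False
    then show ?thesis
      using dilate_relation[OF G, of "q ^ (k div 2)"]
      by (simp add: T_def C_numerator_def dilate_dilate mult_ac)
  qed
  hence "C 1 q = T 0" by (rule C_eqI)
  thus ?thesis by (simp add: T_def fps_eq_iff)
qed

text \<open>With labels of type \<^typ>\<open>unit\<close> the trees are bare shapes, so there are finitely many of each
  size.\<close>

definition tree_gf :: "(unit tree \<Rightarrow> 'a::comm_ring_1) \<Rightarrow> 'a fps" where
  "tree_gf f = Abs_fps (\<lambda>n. \<Sum>t | size t = n. f t)"

lemma trees_Suc:
  "{t :: unit tree. size t = Suc n} =
     (\<lambda>(l, r). \<langle>l, (), r\<rangle>) ` (\<Union>i\<le>n. {l. size l = i} \<times> {r. size r = n - i})"
  (is "?L = ?R")
proof
  show "?L \<subseteq> ?R"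
  proof
    fix t :: "unit tree" assume t: "t \<in> ?L"
    then obtain l r where "t = \<langle>l, (), r\<rangle>" by (cases t) auto
    thus "t \<in> ?R" using t by (force simp: image_iff)
  qed
qed auto

lemma finite_trees: "finite {t :: unit tree. size t = n}"
proof (induction n rule: less_induct)
  case (less n)
  show ?case
  proof (cases n)
    case (Suc m)
    have "finite (\<Union>i\<le>m. {l :: unit tree. size l = i} \<times> {r :: unit tree. size r = m - i})"
      using Suc by (intro finite_UN_I finite_cartesian_product less) auto
    thus ?thesis unfolding Suc trees_Suc by simp
  qed simp
qed

text \<open>The sum of two products serves \<^const>\<open>vinc231\<close>, where the weight of the right subtree depends on
  whether the left one is empty.\<close>

lemma tree_gf_Node:
  assumes "\<And>l r. f \<langle>l, (), r\<rangle> = g1 l * h1 r + g2 l * h2 r"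
  shows "tree_gf f = fps_const (f \<langle>\<rangle>) + fps_X * (tree_gf g1 * tree_gf h1 + tree_gf g2 * tree_gf h2)"
proof (rule fps_ext)
  fix n
  show "tree_gf f $ n =
    (fps_const (f \<langle>\<rangle>) + fps_X * (tree_gf g1 * tree_gf h1 + tree_gf g2 * tree_gf h2)) $ n"
  proof (cases n)
    case 0
    then show ?thesis by (simp add: tree_gf_def)
  next
    case (Suc m)
    let ?D = "\<lambda>i. {l :: unit tree. size l = i} \<times> {r :: unit tree. size r = m - i}"
    have "tree_gf f $ n = (\<Sum>(l, r) \<in> (\<Union>i\<le>m. ?D i). f \<langle>l, (), r\<rangle>)"
      unfolding tree_gf_def Suc fps_nth_Abs_fps trees_Suc
      by (subst sum.reindex) (auto simp: inj_on_def split_def)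
    also have "\<dots> = (\<Sum>i\<le>m. \<Sum>(l, r) \<in> ?D i. f \<langle>l, (), r\<rangle>)"
      by (rule sum.UNION_disjoint) (auto simp: finite_trees)
    also have "\<dots> = (\<Sum>i\<le>m. tree_gf g1 $ i * tree_gf h1 $ (m - i)
                             + tree_gf g2 $ i * tree_gf h2 $ (m - i))"
      by (intro sum.cong refl)
        (simp add: assms tree_gf_def sum_product sum.cartesian_product split_def sum.distrib)
    also have "\<dots> = (tree_gf g1 * tree_gf h1 + tree_gf g2 * tree_gf h2) $ m"
      by (simp add: fps_mult_nth sum.distrib atLeast0AtMost)
    finally show ?thesis by (simp add: Suc)
  qed
qed

lemma tree_gf_Node_product:
  assumes "\<And>l r. f \<langle>l, (), r\<rangle> = g l * h r"
  shows "tree_gf f = fps_const (f \<langle>\<rangle>) + fps_X * (tree_gf g * tree_gf h)"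
proof -
  have "tree_gf (\<lambda>_. 0 :: 'a) = 0" by (simp add: tree_gf_def fps_eq_iff)
  thus ?thesis using tree_gf_Node[of f g h "\<lambda>_. 0" "\<lambda>_. 0"] assms by simp
qed

lemma tree_gf_dilate: "tree_gf (\<lambda>t. q ^ size t * f t) = dilate q (tree_gf f)"
  by (simp add: fps_eq_iff tree_gf_def sum_distrib_left)

text \<open>The recursion for \<^const>\<open>vinc213\<close> involves the size of the right subtree of the left child.
  Adding this size to the statistic gives the series \<open>G\<close>; the recursion of the new statistic
  multiplies the weight of a right subtree \<open>d\<close> by \<open>q\<^bsup>size d\<^esup>\<close>, which is the source of \<open>F(q x)\<close>.
  A leaf keeps the weight 1 because \<^term>\<open>right \<langle>\<rangle> = \<langle>\<rangle>\<close>.\<close>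

lemma vinc213_gf_relations:
  fixes q :: "'a::idom"
  defines "F \<equiv> tree_gf (\<lambda>t. q ^ vinc213 t)"
  obtains G where "F * (1 - fps_X * G) = 1" "G * (1 - fps_X * dilate q F) = 1"
proof -
  define g where "g u = q ^ (vinc213 u + size (right u))" for u :: "unit tree"
  have "F = 1 + fps_X * (tree_gf g * F)"
    unfolding F_def
    using tree_gf_Node_product[of "\<lambda>t. q ^ vinc213 t" g "\<lambda>t. q ^ vinc213 t"]
    by (simp add: g_def power_add mult_ac)
  moreover have "tree_gf g = 1 + fps_X * (tree_gf g * dilate q F)"
    unfolding F_def tree_gf_dilate[symmetric]
    using tree_gf_Node_product[of g g "\<lambda>t. q ^ size t * q ^ vinc213 t"]
    by (simp add: g_def power_add mult_ac)
  ultimately show thesis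
    by (intro that[of "tree_gf g"]) (simp_all add: algebra_simps)
qed

lemma vinc213_gf:
  fixes q :: "'a::idom"
  shows "C 1 q = tree_gf (\<lambda>t. q ^ vinc213 t)"
  by (rule vinc213_gf_relations[of q]) (rule C_one_eqI)

text \<open>The recursion gives \<open>F = 1 + x (F + (F - 1) F(q x))\<close>, where the first summand \<open>F\<close> stems from an
  empty left subtree. Solved for \<open>F\<close>, this is the two-level fraction with
  \<open>G = 1 / (1 - x F(q x))\<close>.\<close>

lemma vinc231_gf:
  fixes q :: "'a::idom"
  shows "C 1 q = tree_gf (\<lambda>t. q ^ vinc231 t)"
proof -
  define f where "f t = q ^ vinc231 t" for t :: "unit tree"
  define e :: "unit tree \<Rightarrow> 'a" where "e t = (if t = \<langle>\<rangle> then 1 else 0)" for t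
  let ?F = "tree_gf f"
  have "f \<langle>l, (), r\<rangle> = e l * f r + (f l - e l) * (q ^ size r * f r)" for l r
    by (simp add: f_def e_def power_add mult_ac)
  hence "?F = fps_const (f \<langle>\<rangle>) + fps_X * (tree_gf e * ?F + tree_gf (\<lambda>t. f t - e t) * dilate q ?F)"
    unfolding tree_gf_dilate[symmetric] by (rule tree_gf_Node)
  moreover have e: "tree_gf e = 1"
    by (simp add: tree_gf_def e_def fps_eq_iff sum.delta finite_trees)
  moreover have "tree_gf (\<lambda>t. f t - e t) = ?F - 1"
    unfolding e[symmetric] by (simp add: tree_gf_def fps_eq_iff sum_subtractf)
  ultimately have F: "?F = 1 + fps_X * (?F + (?F - 1) * dilate q ?F)"
    by (simp add: f_def)
  define D where "D = 1 - fps_X * dilate q ?F"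
  define G where "G = fps_recip D"
  have G: "D * G = 1" unfolding G_def by (rule fps_recip) (simp add: D_def)
  have "?F * D - fps_X * ?F = D"
    using F unfolding D_def by (simp add: algebra_simps)
  hence "(?F * D - fps_X * ?F) * G = 1" using G by simp
  moreover have "(?F * D - fps_X * ?F) * G = ?F * (D * G - fps_X * G)"
    by (simp add: algebra_simps)
  ultimately have "?F * (1 - fps_X * G) = 1" using G by simp
  moreover have "G * (1 - fps_X * dilate q ?F) = 1" using G by (simp add: D_def mult.commute)
  ultimately have "C 1 q = ?F" by (rule C_one_eqI)
  thus ?thesis by (simp add: f_def[abs_def])
qed

lemma alpha213_gf:
  fixes q :: "'a::idom"
  shows "tree_gf (\<lambda>t. q ^ alpha213 t) = fps_recip (1 - fps_X * C 1 q)"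
proof (rule fps_recip_unique)
  let ?F = "tree_gf (\<lambda>t. q ^ alpha213 t)"
  have "?F = 1 + fps_X * (?F * C 1 q)"
    unfolding vinc213_gf
    using tree_gf_Node_product[of "\<lambda>t. q ^ alpha213 t" "\<lambda>t. q ^ alpha213 t" "\<lambda>t. q ^ vinc213 t"]
    by (simp add: power_add)
  thus "(1 - fps_X * C 1 q) * ?F = 1" by (simp add: algebra_simps)
qed simp

lemma alpha231_gf:
  fixes q :: "'a::idom"
  shows "tree_gf (\<lambda>t. q ^ alpha231 t) = fps_recip (1 - fps_X * C 1 q)"
proof (rule fps_recip_unique)
  let ?F = "tree_gf (\<lambda>t. q ^ alpha231 t)"
  have "?F = 1 + fps_X * (?F * C 1 q)"
    unfolding vinc231_gf
    using tree_gf_Node_product[of "\<lambda>t. q ^ alpha231 t" "\<lambda>t. q ^ alpha231 t" "\<lambda>t. q ^ vinc231 t"]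
    by (simp add: power_add)
  thus "(1 - fps_X * C 1 q) * ?F = 1" by (simp add: algebra_simps)
qed simp

section \<open>The two generating functions and the Fibonacci numbers\<close>

text \<open>The assumption on the value at the leaf accounts for the constant term of \<^const>\<open>R\<close>, which is 1 by
  definition.\<close>

lemma R_eq_tree_gf:
  fixes q :: "'a::comm_ring_1"
  assumes sum: "\<And>(g :: nat \<Rightarrow> 'a) n.
      (\<Sum>\<sigma> \<in> avoiders n p. g (alpha n \<sigma>)) = (\<Sum>t | size t = n. g (f (t :: unit tree)))"
    and "f \<langle>\<rangle> = 0"
  shows "R p q = tree_gf (\<lambda>t. q ^ f t)"
proof (rule fps_ext)
  fix n
  have "R p q $ n = (if n = 0 then 1 else \<Sum>\<sigma> \<in> avoiders n p. q ^ alpha n \<sigma>)"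
    by (simp add: R_def)
  also have "\<dots> = (\<Sum>t | size t = n. q ^ f t)"
    using sum[of "\<lambda>m. q ^ m" n] assms(2) by auto
  finally show "R p q $ n = tree_gf (\<lambda>t. q ^ f t) $ n" by (simp add: tree_gf_def)
qed

theorem R_213:
  fixes q :: "'a::idom"
  shows "R [2,1,3] q = fps_recip (1 - fps_X * C 1 q)"
  using R_eq_tree_gf[OF sum_avoiders213, of q] by (simp add: alpha213_gf)

theorem R_231:
  fixes q :: "'a::idom"
  shows "R [2,3,1] q = fps_recip (1 - fps_X * C 1 q)"
  using R_eq_tree_gf[OF sum_avoiders231, of q] by (simp add: alpha231_gf)

text \<open>By \<open>0\<^sup>0 = 1\<close>, the specialization \<open>q = 0\<close> keeps exactly the permutations without an occurrence.\<close>

lemma a_count_alpha_pattern: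
  assumes "n \<ge> 1"
  shows "int (a_count n p alpha_pattern) = R p (0 :: int) $ n"
proof -
  have fin: "finite (avoiders n p)"
    by (simp add: avoiders_def perms_def finite_permutations)
  have "finite (arrow_occurrences alpha_pattern n \<sigma>)" for \<sigma>
    by (rule finite_subset[of _ "Pow {1..n}"]) (auto simp: arrow_occurrences_def)
  hence "arrow_occurrences alpha_pattern n \<sigma> = {} \<longleftrightarrow> alpha n \<sigma> = 0" for \<sigma>
    by (simp add: alpha_def)
  hence "int (a_count n p alpha_pattern) = (\<Sum>\<sigma> \<in> avoiders n p. if alpha n \<sigma> = 0 then 1 else 0)"
    using fin by (simp add: a_count_def sum.If_cases Int_def)
  also have "\<dots> = R p 0 $ n"
    using assms by (simp add: R_def power_0_left)
  finally show ?thesis .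
qed

lemma fib_odd_Suc: "fib (2 * Suc (Suc n) + 1) + fib (2 * n + 1) = 3 * fib (2 * Suc n + 1)"
  by (simp add: numeral_eq_Suc)

text \<open>For \<open>q = 0\<close> the series \<open>F(q x)\<close> reduces to its constant term 1, so \<open>G = 1 / (1 - x)\<close>
  and \<open>F = (1 - x) / (1 - 2x)\<close>. Hence
  \<open>(1 - 3x + x\<^sup>2) R = 1 - 2x\<close>, and the coefficients of \<open>R\<close> satisfy \<open>r\<^sub>n\<^sub>+\<^sub>2 = 3 r\<^sub>n\<^sub>+\<^sub>1 - r\<^sub>n\<close>.\<close>

lemma specialization_at_0_nth:
  assumes "n \<ge> 1"
  shows "fps_recip (1 - fps_X * C 1 (0::int)) $ n = int (fib (2 * n - 1))"
proof -
  define F where "F = C 1 (0::int)"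
  define r where "r = fps_recip (1 - fps_X * F)"
  obtain G where FG: "F * (1 - fps_X * G) = 1" and G: "G * (1 - fps_X * dilate 0 F) = 1"
    unfolding F_def vinc213_gf by (rule vinc213_gf_relations)
  have "F $ 0 = 1" using arg_cong[OF FG, of "\<lambda>f. f $ 0"] by simp
  hence "dilate 0 F = 1" by (simp add: fps_eq_iff)
  with G have G: "G * (1 - fps_X) = 1" by simp
  have "F * ((1 - fps_X) - fps_X * (G * (1 - fps_X))) = (F * (1 - fps_X * G)) * (1 - fps_X)"
    by (simp add: algebra_simps)
  hence F: "F * (1 - 2 * fps_X) = 1 - fps_X"
    unfolding G FG by (simp add: algebra_simps)
  have "(1 - fps_X * F) * r = 1" unfolding r_def by (rule fps_recip) simp
  hence "((1 - 2 * fps_X) - fps_X * (F * (1 - 2 * fps_X))) * r = 1 - 2 * fps_X"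
    by (metis (no_types, opaque_lifting) left_diff_distrib mult.assoc mult.commute mult.left_neutral)
  hence eq: "r = 1 - 2 * fps_X + fps_X * (3 * r) - fps_X * (fps_X * r)"
    unfolding F by (simp add: algebra_simps)
  have r0: "r $ 0 = 1" using arg_cong[OF eq, of "\<lambda>f. f $ 0"] by simp
  have r1: "r $ 1 = 1" using arg_cong[OF eq, of "\<lambda>f. f $ 1"] r0 by (simp add: numeral_fps_const)
  have rec: "r $ (Suc (Suc n)) = 3 * r $ Suc n - r $ n" for n
    using arg_cong[OF eq, of "\<lambda>f. f $ Suc (Suc n)"] by (simp add: numeral_fps_const)
  have "r $ (Suc n) = int (fib (2 * n + 1)) \<and> r $ Suc (Suc n) = int (fib (2 * Suc n + 1))" for n
  proof (induction n)
    case 0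
    show ?case using r0 r1 rec[of 0] by (simp add: numeral_eq_Suc)
  next
    case (Suc n)
    then show ?case using rec[of "Suc n"] fib_odd_Suc[of n] by linarith
  qed
  from this[of "n - 1"] assms show ?thesis by (cases n) (auto simp: r_def F_def)
qed

theorem theorem3p5:
  shows "R [2,1,3] q_var = R [2,3,1] q_var
    \<and> R [2,3,1] q_var = fps_recip (1 - fps_X * C 1 q_var)
    \<and> (\<forall>n\<ge>1. a_count n [2,1,3] alpha_pattern = a_count n [2,3,1] alpha_pattern
             \<and> a_count n [2,3,1] alpha_pattern = fib (2 * n - 1))"
proof (intro conjI allI impI)
  show "R [2,1,3] q_var = R [2,3,1] q_var" by (simp only: R_213 R_231)
  show "R [2,3,1] q_var = fps_recip (1 - fps_X * C 1 q_var)" by (rule R_231)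
  fix n :: nat assume n: "n \<ge> 1"
  have "int (a_count n p alpha_pattern) = int (fib (2 * n - 1))" if "p \<in> {[2,1,3], [2,3,1]}" for p
  proof -
    have "R p (0 :: int) = fps_recip (1 - fps_X * C 1 0)"
      using that by (auto simp only: insert_iff empty_iff R_213 R_231)
    thus ?thesis
      using a_count_alpha_pattern[OF n, of p] specialization_at_0_nth[OF n] by (simp only:)
  qed
  thus "a_count n [2,3,1] alpha_pattern = fib (2 * n - 1)"
    "a_count n [2,1,3] alpha_pattern = a_count n [2,3,1] alpha_pattern" by simp_all
qed

end
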